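(* Let $X$ be a Tychonoff space such that $C_c(X)$ is a Fréchet locally convex space. Then the following are equivalent: (a) $C_c(X)$ is a weakly $\aleph$-space; (b) $C_c(X)$ is a weakly $\aleph_0$-space; (c) $X$ is countable.
   Context: $C_c(X)$ denotes the space of all continuous real-valued functions on $X$ with the compact-open topology. A Fréchet lcs is a metrizable complete locally convex space. A family $\mathcal N$ of subsets of a topological space $Y$ is a $k$-network if whenever $K\subset U$ with $K$ compact and $U$ open in $Y$, there is a finite $\mathcal F\subset\mathcal N$ with $K\subset\bigcup\mathcal F\subset U$. A space is an $\aleph_0$-space if it is regular and has a countable $k$-network, and an $\aleph$-space if it is regular and has a $\sigma$-locally finite $k$-network. A locally convex space $E$ is a weakly $\aleph$-space (resp. weakly $\aleph_0$-space) if $E$ endowed with its weak topology $\sigma(E,E')$ is an $\aleph$-space (resp. $\aleph_0$-space). *)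

theory Defs
  imports "HOL-Analysis.Analysis"
begin

text \<open>Carrier of C(X): continuous real functions on X, normalised to 0 outside topspace X
  (so that each continuous function on X is represented exactly once).\<close>
definition Cfun :: "'a topology \<Rightarrow> ('a \<Rightarrow> real) set" where
  "Cfun X = {f. continuous_map X euclideanreal f \<and> (\<forall>x. x \<notin> topspace X \<longrightarrow> f x = 0)}"

definition compact_open :: "'a topology \<Rightarrow> ('a \<Rightarrow> real) topology" where
  "compact_open X = topology_generated_by
     {{f \<in> Cfun X. f ` K \<subseteq> U} | K U. compactin X K \<and> open U}"

definition dual_Cc :: "'a topology \<Rightarrow> (('a \<Rightarrow> real) \<Rightarrow> real) set" where
  "dual_Cc X = {\<phi>. continuous_map (compact_open X) euclideanreal \<phi> \<and>
     (\<forall>f\<in>Cfun X. \<forall>g\<in>Cfun X. \<phi> (\<lambda>x. f x + g x) = \<phi> f + \<phi> g) \<and>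
     (\<forall>f\<in>Cfun X. \<forall>c::real. \<phi> (\<lambda>x. c * f x) = c * \<phi> f)}"

definition weak_Cc :: "'a topology \<Rightarrow> ('a \<Rightarrow> real) topology" where
  "weak_Cc X = topology_generated_by
     {{f \<in> Cfun X. \<phi> f \<in> U} | \<phi> U. \<phi> \<in> dual_Cc X \<and> open U}"

text \<open>Frechet: metrizable and complete. For a metrizable TVS completeness is equivalent to
  sequential completeness w.r.t. the canonical (translation-invariant) uniformity.\<close>
definition Frechet_Cc :: "'a topology \<Rightarrow> bool" where
  "Frechet_Cc X \<longleftrightarrow> metrizable_space (compact_open X) \<and>
     (\<forall>s :: nat \<Rightarrow> ('a \<Rightarrow> real). (\<forall>n. s n \<in> Cfun X) \<and>
        (\<forall>U. openin (compact_open X) U \<and> (\<lambda>x. 0) \<in> U \<longrightarrow>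
              (\<exists>N. \<forall>m\<ge>N. \<forall>n\<ge>N. (\<lambda>x. s m x - s n x) \<in> U))
        \<longrightarrow> (\<exists>g. limitin (compact_open X) s g sequentially))"

definition k_network :: "'b topology \<Rightarrow> 'b set set \<Rightarrow> bool" where
  "k_network Y \<N> \<longleftrightarrow> (\<forall>N\<in>\<N>. N \<subseteq> topspace Y) \<and>
     (\<forall>K U. compactin Y K \<and> openin Y U \<and> K \<subseteq> U \<longrightarrow>
        (\<exists>\<F>. finite \<F> \<and> \<F> \<subseteq> \<N> \<and> K \<subseteq> \<Union>\<F> \<and> \<Union>\<F> \<subseteq> U))"

definition aleph0_space :: "'b topology \<Rightarrow> bool" where
  "aleph0_space Y \<longleftrightarrow> regular_space Y \<and> (\<exists>\<N>. countable \<N> \<and> k_network Y \<N>)"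

definition aleph_space :: "'b topology \<Rightarrow> bool" where
  "aleph_space Y \<longleftrightarrow> regular_space Y \<and>
     (\<exists>\<N> :: nat \<Rightarrow> 'b set set. (\<forall>n. locally_finite_in Y (\<N> n)) \<and> k_network Y (\<Union>n. \<N> n))"

end

theory Submission
  imports Defs
begin

text \<open>
  A functional \<open>\<phi>\<close> on \<open>C\<^sub>c(X)\<close> is bounded by a multiple of the supremum over some compact set, so it
  tends to \<open>0\<close> along every bounded sequence of functions with pairwise disjoint supports.

  Suppose the weak topology has a \<open>\<sigma>\<close>-locally finite \<open>k\<close>-network. Only countably many members have
  \<open>0\<close> in their closure; let \<open>\<G>\<close> be the countable set of their finite unions, and for \<open>G \<in> \<G>\<close> let
  \<open>T G\<close> be the set of points at which all members of \<open>G\<close> are smaller than \<open>1\<close>. Every \<open>t\<close> lies in a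
  finite \<open>T G\<close>, whence \<open>X\<close> is countable: otherwise enumerate the \<open>G\<close> with \<open>t \<in> T G\<close>, choose distinct
  points in the sets \<open>T\<close> of the increasing unions and disjointly supported bumps at a subsequence of
  them. These bumps converge weakly to \<open>0\<close> inside the open set \<open>{h. \<bar>h t\<bar> < 1}\<close>, but eventually escape
  every \<open>G\<close> contained in it.

  Conversely, if \<open>X\<close> is countable then on uniformly bounded sets every functional is continuous for
  pointwise convergence, since a finite partition of unity subordinate to small neighbourhoods of the
  points approximates it in norm by combinations of point evaluations. As weakly compact sets are
  bounded on compact sets, intersecting the members of a countable base for pointwise convergence
  with bounds on countably many compact sets gives a countable \<open>k\<close>-network.
\<close>

section \<open>Continuous functions\<close>

lemma Cfun_zero: "(\<lambda>x. 0) \<in> Cfun X"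
  by (simp add: Cfun_def)

lemma Cfun_add: "f \<in> Cfun X \<Longrightarrow> g \<in> Cfun X \<Longrightarrow> (\<lambda>x. f x + g x) \<in> Cfun X"
  unfolding Cfun_def by (simp add: continuous_intros)

lemma Cfun_diff: "f \<in> Cfun X \<Longrightarrow> g \<in> Cfun X \<Longrightarrow> (\<lambda>x. f x - g x) \<in> Cfun X"
  unfolding Cfun_def by (simp add: continuous_intros)

lemma Cfun_scale: "f \<in> Cfun X \<Longrightarrow> (\<lambda>x. c * f x) \<in> Cfun X"
  unfolding Cfun_def by (simp add: continuous_intros)

lemma Cfun_sum: "(\<And>i. i \<in> I \<Longrightarrow> f i \<in> Cfun X) \<Longrightarrow> (\<lambda>x. \<Sum>i\<in>I. f i x) \<in> Cfun X"
  by (induction I rule: infinite_finite_induct) (auto intro: Cfun_zero Cfun_add)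

lemma Cfun_mult:
  "f \<in> Cfun X \<Longrightarrow> continuous_map X euclideanreal g \<Longrightarrow> (\<lambda>x. f x * g x) \<in> Cfun X"
  unfolding Cfun_def by (simp add: continuous_intros)

lemma Cfun_clip: "f \<in> Cfun X \<Longrightarrow> 0 \<le> d \<Longrightarrow> (\<lambda>x. max (- d) (min d (f x))) \<in> Cfun X"
  unfolding Cfun_def by (simp add: continuous_intros)

lemma Cfun_continuous_map: "f \<in> Cfun X \<Longrightarrow> continuous_map X euclideanreal f"
  by (simp add: Cfun_def)

lemma openin_Cfun_vimage: "f \<in> Cfun X \<Longrightarrow> open U \<Longrightarrow> openin X {x \<in> topspace X. f x \<in> U}"
  by (metis Cfun_continuous_map open_openin openin_continuous_map_preimage)

lemma Cfun_bump:
  assumes "completely_regular_space X" "openin X G" "a \<in> G"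
  obtains u where "u \<in> Cfun X" "u a = 1" "\<And>x. 0 \<le> u x" "\<And>x. u x \<le> 1" "\<And>x. x \<notin> G \<Longrightarrow> u x = 0"
proof -
  have "closedin X (topspace X - G)" "a \<in> topspace X - (topspace X - G)"
    using assms openin_subset by fastforce+
  then obtain f where f: "continuous_map X (top_of_set {0..1::real}) f" "f a = 0"
      "f ` (topspace X - G) \<subseteq> {1}"
    using assms(1) unfolding completely_regular_space_def by meson
  \<comment> \<open>The separating function is 0 at \<open>a\<close> and 1 off \<open>G\<close>,
    hence the flip; the cut-off outside \<open>topspace X\<close> is the normalisation demanded by
    \<open>Cfun\<close>.\<close>
  define u where "u = (\<lambda>x. if x \<in> topspace X then 1 - f x else 0)"
  have fr: "continuous_map X euclideanreal f" "\<And>x. x \<in> topspace X \<Longrightarrow> f x \<in> {0..1}"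
    using f(1) by (auto simp: continuous_map_in_subtopology)
  have "continuous_map X euclideanreal (\<lambda>x. 1 - f x)"
    using fr by (intro continuous_intros)
  then have "continuous_map X euclideanreal u"
    by (rule continuous_map_eq) (auto simp: u_def)
  moreover have "a \<in> topspace X"
    using assms openin_subset by blast
  ultimately show ?thesis
    using that[of u] f fr by (fastforce simp: u_def Cfun_def)
qed

section \<open>Functionals bounded on a compact set\<close>

text \<open>Linearity together with domination by \<open>C\<close> times the sup-seminorm of
  \<open>K\<close>. Quantifying over all bounds \<open>b\<close> avoids a supremum over a possibly
  empty \<open>K\<close>, and the value \<open>b = 0\<close> is allowed on purpose.\<close>

definition bounded_functional :: "'a topology \<Rightarrow> 'a set \<Rightarrow> real \<Rightarrow> (('a \<Rightarrow> real) \<Rightarrow> real) \<Rightarrow> bool" where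
  "bounded_functional X K C \<phi> \<longleftrightarrow> 0 \<le> C \<and>
     (\<forall>f\<in>Cfun X. \<forall>g\<in>Cfun X. \<phi> (\<lambda>x. f x + g x) = \<phi> f + \<phi> g) \<and>
     (\<forall>f\<in>Cfun X. \<forall>c. \<phi> (\<lambda>x. c * f x) = c * \<phi> f) \<and>
     (\<forall>f\<in>Cfun X. \<forall>b\<ge>0. (\<forall>x\<in>K. \<bar>f x\<bar> \<le> b) \<longrightarrow> \<bar>\<phi> f\<bar> \<le> C * b)"

context
  fixes X :: "'a topology" and K C \<phi>
  assumes \<phi>: "bounded_functional X K C \<phi>"
begin

lemma bounded_functional_nonneg: "0 \<le> C"
  using \<phi> by (simp add: bounded_functional_def)

lemma bounded_functional_add:
  "f \<in> Cfun X \<Longrightarrow> g \<in> Cfun X \<Longrightarrow> \<phi> (\<lambda>x. f x + g x) = \<phi> f + \<phi> g"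
  using \<phi> by (simp add: bounded_functional_def)

lemma bounded_functional_scale: "f \<in> Cfun X \<Longrightarrow> \<phi> (\<lambda>x. c * f x) = c * \<phi> f"
  using \<phi> by (simp add: bounded_functional_def)

lemma bounded_functional_bound:
  "f \<in> Cfun X \<Longrightarrow> 0 \<le> b \<Longrightarrow> (\<And>x. x \<in> K \<Longrightarrow> \<bar>f x\<bar> \<le> b) \<Longrightarrow> \<bar>\<phi> f\<bar> \<le> C * b"
  using \<phi> by (simp add: bounded_functional_def)

lemma bounded_functional_zero: "\<phi> (\<lambda>x. 0) = 0"
  using bounded_functional_scale[OF Cfun_zero, of 0] by simp

lemma bounded_functional_diff:
  assumes "f \<in> Cfun X" "g \<in> Cfun X"
  shows "\<phi> (\<lambda>x. f x - g x) = \<phi> f - \<phi> g"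
  using bounded_functional_add[OF assms(1) Cfun_scale[OF assms(2), of "-1"]]
    bounded_functional_scale[OF assms(2), of "-1"] by simp

lemma bounded_functional_sum:
  "(\<And>i. i \<in> I \<Longrightarrow> f i \<in> Cfun X) \<Longrightarrow> \<phi> (\<lambda>x. \<Sum>i\<in>I. f i x) = (\<Sum>i\<in>I. \<phi> (f i))"
proof (induction I rule: infinite_finite_induct)
  case (insert i I)
  then show ?case
    using bounded_functional_add[of "f i" "\<lambda>x. \<Sum>i\<in>I. f i x"] by (auto simp: Cfun_sum)
qed (auto simp: bounded_functional_zero)

text \<open>The bound with \<open>b = 0\<close> kills the difference: only the restriction to
  \<open>K\<close> matters, so functions may be altered freely off \<open>K\<close>.\<close>

lemma bounded_functional_cong:
  assumes "f \<in> Cfun X" "g \<in> Cfun X" "\<And>x. x \<in> K \<Longrightarrow> f x = g x"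
  shows "\<phi> f = \<phi> g"
  using bounded_functional_bound[OF Cfun_diff[OF assms(1,2)], of 0] assms
  by (simp add: bounded_functional_diff)

text \<open>Choosing signs, the partial sums of \<open>\<Sum>\<bar>\<phi> (f i)\<bar>\<close> are values of \<open>\<phi>\<close> at functions bounded by 1.\<close>

lemma bounded_functional_disjoint_tendsto_0:
  assumes f: "\<And>i::nat. f i \<in> Cfun X" and le1: "\<And>i x. \<bar>f i x\<bar> \<le> 1"
    and disj: "\<And>i j x. i \<noteq> j \<Longrightarrow> f i x \<noteq> 0 \<Longrightarrow> f j x = 0"
  shows "(\<lambda>i. \<phi> (f i)) \<longlonglongrightarrow> 0"
proof -
  have "(\<Sum>i<n. \<bar>\<phi> (f i)\<bar>) \<le> C" for n
  proof -
    let ?g = "\<lambda>x. \<Sum>i<n. sgn (\<phi> (f i)) * f i x"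
    \<comment> \<open>By disjointness at most one summand is nonzero at each point.\<close>
    have le: "\<bar>?g x\<bar> \<le> 1" for x
    proof (cases "\<exists>i<n. f i x \<noteq> 0")
      case True
      then obtain i where i: "i < n" "f i x \<noteq> 0"
        by blast
      have "?g x = (\<Sum>j<n. if j = i then sgn (\<phi> (f i)) * f i x else 0)"
        by (rule sum.cong) (use disj[of i _ x] i in auto)
      also have "\<dots> = sgn (\<phi> (f i)) * f i x"
        using i by simp
      finally show ?thesis
        using le1[of i x] by (simp add: abs_mult sgn_if)
    next
      case False
      then have "?g x = 0"
        by (intro sum.neutral) auto
      then show ?thesis by simp
    qed
    have "(\<Sum>i<n. \<bar>\<phi> (f i)\<bar>) = (\<Sum>i<n. \<phi> (\<lambda>x. sgn (\<phi> (f i)) * f i x))"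
      by (rule sum.cong) (simp_all add: bounded_functional_scale[OF f], simp add: abs_sgn mult.commute)
    also have "\<dots> = \<phi> ?g"
      using f by (intro bounded_functional_sum[symmetric] Cfun_scale)
    also have "\<dots> \<le> C"
      using bounded_functional_bound[of ?g 1] le f by (simp add: Cfun_sum Cfun_scale)
    finally show ?thesis .
  qed
  then have "summable (\<lambda>i. \<bar>\<phi> (f i)\<bar>)"
    by (intro summableI_nonneg_bounded[where x = C]) auto
  then show ?thesis
    using summable_LIMSEQ_zero tendsto_rabs_zero_iff by blast
qed

end

section \<open>The compact-open topology and its dual\<close>

lemma topspace_compact_open [simp]: "topspace (compact_open X) = Cfun X"
proof
  show "Cfun X \<subseteq> topspace (compact_open X)"
    unfolding compact_open_def topology_generated_by_topspace
    by (rule Union_upper) (auto intro!: exI[of _ "{}"])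
qed (auto simp: compact_open_def)

text \<open>Induction over the generation of the topology: finite intersections are handled by the
  union of the compact sets and the smaller radius.\<close>

lemma compact_open_nhds_zero:
  assumes "openin (compact_open X) W" "(\<lambda>x. 0) \<in> W"
  obtains K e where "compactin X K" "e > 0" "\<And>f. f \<in> Cfun X \<Longrightarrow> (\<And>x. x \<in> K \<Longrightarrow> \<bar>f x\<bar> < e) \<Longrightarrow> f \<in> W"
proof -
  define z where "z = (\<lambda>_::'a. 0::real)"
  have "generate_topology_on {{f \<in> Cfun X. f ` K \<subseteq> U} | K U. compactin X K \<and> open U} W"
    using assms(1) by (simp add: compact_open_def openin_topology_generated_by_iff)
  then have "z \<in> W \<longrightarrow>
      (\<exists>K e. compactin X K \<and> e > 0 \<and> (\<forall>f\<in>Cfun X. (\<forall>x\<in>K. \<bar>f x\<bar> < e) \<longrightarrow> f \<in> W))"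
  proof induction
    case (Int a b)
    show ?case
    proof
      assume "z \<in> a \<inter> b"
      then obtain K e L d where K: "compactin X K" "e > 0" "\<forall>f\<in>Cfun X. (\<forall>x\<in>K. \<bar>f x\<bar> < e) \<longrightarrow> f \<in> a"
        and L: "compactin X L" "d > 0" "\<forall>f\<in>Cfun X. (\<forall>x\<in>L. \<bar>f x\<bar> < d) \<longrightarrow> f \<in> b"
        using Int.IH by auto
      then show "\<exists>K e. compactin X K \<and> e > 0 \<and> (\<forall>f\<in>Cfun X. (\<forall>x\<in>K. \<bar>f x\<bar> < e) \<longrightarrow> f \<in> a \<inter> b)"
        by (intro exI[of _ "K \<union> L"] exI[of _ "min e d"]) (auto simp: compactin_Un)
    qed
  next
    case (UN \<K>)
    show ?case
    proof
      assume "z \<in> \<Union>\<K>"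
      then obtain a where a: "a \<in> \<K>" "z \<in> a" by blast
      then obtain K e where "compactin X K" "e > 0" "\<forall>f\<in>Cfun X. (\<forall>x\<in>K. \<bar>f x\<bar> < e) \<longrightarrow> f \<in> a"
        using UN.IH by blast
      with a(1) show "\<exists>K e. compactin X K \<and> e > 0 \<and> (\<forall>f\<in>Cfun X. (\<forall>x\<in>K. \<bar>f x\<bar> < e) \<longrightarrow> f \<in> \<Union>\<K>)"
        by (intro exI[of _ K] exI[of _ e]) blast
    qed
  next
    case (Basis s)
    then obtain K U where s: "s = {f \<in> Cfun X. f ` K \<subseteq> U}" "compactin X K" "open U"
      by auto
    show ?case
    proof
      assume *: "z \<in> s"
      show "\<exists>K e. compactin X K \<and> e > 0 \<and> (\<forall>f\<in>Cfun X. (\<forall>x\<in>K. \<bar>f x\<bar> < e) \<longrightarrow> f \<in> s)"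
      \<comment> \<open>For empty \<open>K\<close> nothing forces 0 into \<open>U\<close>, but then
        the subbasic set is all of \<open>Cfun X\<close>.\<close>
      proof (cases "K = {}")
        case True
        then show ?thesis using s by (intro exI[of _ K] exI[of _ 1]) auto
      next
        case False
        then have "0 \<in> U" using * s by (auto simp: z_def)
        then obtain e where "e > 0" "\<And>y. \<bar>y\<bar> < e \<Longrightarrow> y \<in> U"
          using s(3) by (auto simp: open_dist dist_real_def)
        then show ?thesis using s by (intro exI[of _ K] exI[of _ e]) auto
      qed
    qed
  qed auto
  then show ?thesis
    using assms(2) that unfolding z_def by blast
qed

text \<open>Subbasic sets control images, not distances to \<open>f\<close>. So \<open>K\<close> is
  cut into finitely many compact pieces \<open>L y\<close> on which \<open>f\<close> stays within
  \<open>d/3\<close> of \<open>y\<close>, and \<open>g\<close> is asked to stay within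
  \<open>d/2\<close> of \<open>y\<close> there; \<open>d/3 + d/2 < d\<close>.\<close>

lemma compact_open_uniform_nhd:
  assumes f: "f \<in> Cfun X" and K: "compactin X K" and d: "d > 0"
  obtains W where "openin (compact_open X) W" "f \<in> W" "\<And>g x. g \<in> W \<Longrightarrow> x \<in> K \<Longrightarrow> \<bar>g x - f x\<bar> \<le> d"
proof -
  have "compact (f ` K)"
    using image_compactin[OF K Cfun_continuous_map[OF f]] by simp
  then obtain T where T: "finite T" "T \<subseteq> f ` K" "f ` K \<subseteq> (\<Union>y\<in>T. ball y (d/3))"
    using d by (elim compactE_image[where C = "f ` K" and f = "\<lambda>y. ball y (d/3)"]) auto
  define L where "L y = K \<inter> {x \<in> topspace X. f x \<in> cball y (d/3)}" for y
  have L: "compactin X (L y)" for y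
    unfolding L_def
    by (intro compact_Int_closedin K closedin_continuous_map_preimage[OF Cfun_continuous_map[OF f]]) auto
  \<comment> \<open>The factor \<open>Cfun X\<close> covers the case of an empty
    \<open>T\<close>.\<close>
  define W where "W = Cfun X \<inter> (\<Inter>y\<in>T. {g \<in> Cfun X. g ` L y \<subseteq> ball y (d/2)})"
  have "openin (compact_open X) {g \<in> Cfun X. g ` L y \<subseteq> ball y (d/2)}" for y
    unfolding compact_open_def by (intro topology_generated_by_Basis) (use L in auto)
  then have "openin (compact_open X) W"
    using openin_topspace[of "compact_open X"] unfolding W_def topspace_compact_open
    by (cases "T = {}") (auto intro!: openin_Int openin_INT2 T)
  moreover have "f \<in> W"
    using f d by (auto simp: W_def L_def dist_real_def)
  moreover have "\<bar>g x - f x\<bar> \<le> d" if g: "g \<in> W" and x: "x \<in> K" for g x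
  proof -
    obtain y where y: "y \<in> T" "dist y (f x) < d/3"
      using T(3) x by auto
    then have "x \<in> L y"
      using x compactin_subset_topspace[OF K] by (auto simp: L_def)
    then have "dist y (g x) < d/2"
      using g y(1) unfolding W_def by fastforce
    then show ?thesis
      using y unfolding dist_real_def by linarith
  qed
  ultimately show ?thesis
    using that by blast
qed

lemma bounded_functional_imp_dual:
  assumes \<phi>: "bounded_functional X K C \<phi>" and K: "compactin X K"
  shows "\<phi> \<in> dual_Cc X"
proof -
  have "continuous_map (compact_open X) euclideanreal \<phi>"
    unfolding continuous_map_def
  proof (intro conjI allI impI)
    fix U :: "real set" assume "openin euclideanreal U"
    then have U: "open U" by simp
    show "openin (compact_open X) {f \<in> topspace (compact_open X). \<phi> f \<in> U}"
    proof (subst openin_subopen, intro ballI)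
      fix f assume "f \<in> {f \<in> topspace (compact_open X). \<phi> f \<in> U}"
      then have f: "f \<in> Cfun X" "\<phi> f \<in> U" by auto
      then obtain e where e: "e > 0" "\<And>y. \<bar>y - \<phi> f\<bar> < e \<Longrightarrow> y \<in> U"
        using U by (auto simp: open_dist dist_real_def)
      have C: "C \<ge> 0" by (rule bounded_functional_nonneg[OF \<phi>])
      \<comment> \<open>Adding 1 allows \<open>C = 0\<close> and makes \<open>C * d < e\<close>
        strict.\<close>
      define d where "d = e / (C + 1)"
      have d: "d > 0" "C * d < e"
        using e C by (auto simp: d_def field_simps)
      obtain W where W: "openin (compact_open X) W" "f \<in> W"
        "\<And>g x. g \<in> W \<Longrightarrow> x \<in> K \<Longrightarrow> \<bar>g x - f x\<bar> \<le> d"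
        using compact_open_uniform_nhd[OF f(1) K d(1)] by metis
      have "W \<subseteq> {f \<in> topspace (compact_open X). \<phi> f \<in> U}"
      proof
        fix g assume g: "g \<in> W"
        then have g': "g \<in> Cfun X" using openin_subset[OF W(1)] by auto
        have "\<bar>\<phi> (\<lambda>x. g x - f x)\<bar> \<le> C * d"
          using W(3)[OF g] d by (intro bounded_functional_bound[OF \<phi>] Cfun_diff g' f) auto
        then show "g \<in> {f \<in> topspace (compact_open X). \<phi> f \<in> U}"
          using e d g' f by (auto simp: bounded_functional_diff[OF \<phi>])
      qed
      then show "\<exists>T. openin (compact_open X) T \<and> f \<in> T \<and> T \<subseteq> {f \<in> topspace (compact_open X). \<phi> f \<in> U}"
        using W by blast
    qed
  qed auto
  then show ?thesis
    using \<phi> by (auto simp: dual_Cc_def bounded_functional_def)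
qed

text \<open>Homogeneity: rescale \<open>f\<close> until it is below \<open>e\<close> on
  \<open>K\<close>. The constant 2 pays for the strict inequality.\<close>

lemma bounded_functional_from_nhd:
  assumes \<phi>: "\<phi> \<in> dual_Cc X" and e: "e > 0"
    and lt1: "\<And>f. f \<in> Cfun X \<Longrightarrow> (\<And>x. x \<in> K \<Longrightarrow> \<bar>f x\<bar> < e) \<Longrightarrow> \<bar>\<phi> f\<bar> < 1"
  shows "bounded_functional X K (2 / e) \<phi>"
proof -
  have scale: "\<phi> (\<lambda>x. c * f x) = c * \<phi> f" if "f \<in> Cfun X" for f c
    using \<phi> that by (simp add: dual_Cc_def)
  have "\<bar>\<phi> f\<bar> \<le> 2 / e * b" if f: "f \<in> Cfun X" and b: "b \<ge> 0" "\<forall>x\<in>K. \<bar>f x\<bar> \<le> b" for f b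
  proof (rule field_le_epsilon)
    fix d :: real assume "d > 0"
    \<comment> \<open>Chosen so that \<open>1 / c = 2 / e * b + d\<close>, with the scaled function
      at most \<open>e / 2\<close> on \<open>K\<close>. The slack \<open>d\<close> keeps the
      denominator positive when \<open>b = 0\<close>.\<close>
    define c where "c = e / (2 * (b + d * e / 2))"
    have pos: "b + d * e / 2 > 0" using b e \<open>d > 0\<close> by (simp add: add_nonneg_pos)
    then have c: "c > 0" using e by (simp add: c_def)
    have "\<bar>c * f x\<bar> < e" if "x \<in> K" for x
    proof -
      have "\<bar>c * f x\<bar> \<le> c * (b + d * e / 2)"
        using b that c e \<open>d > 0\<close> by (auto simp: abs_mult intro!: mult_left_mono add_increasing2)
      also have "\<dots> = e / 2" 
        unfolding c_def using pos by (subst times_divide_eq_left, subst nonzero_divide_eq_eq) auto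
      finally show ?thesis using e by linarith
    qed
    then have "c * \<bar>\<phi> f\<bar> < 1"
      using lt1[OF Cfun_scale[OF f, of c]] scale[OF f, of c] c by (simp add: abs_mult)
    then have "\<bar>\<phi> f\<bar> < 1 / c" using c by (simp add: field_simps)
    also have "\<dots> = 2 / e * b + d"
      using e pos by (simp add: c_def field_simps)
    finally show "\<bar>\<phi> f\<bar> \<le> 2 / e * b + d" by simp
  qed
  then show ?thesis
    using \<phi> e by (simp add: bounded_functional_def dual_Cc_def)
qed

lemma dual_unit_nhd:
  assumes "\<phi> \<in> dual_Cc X"
  shows "openin (compact_open X) {f \<in> Cfun X. \<bar>\<phi> f\<bar> < 1}" "(\<lambda>x. 0) \<in> {f \<in> Cfun X. \<bar>\<phi> f\<bar> < 1}"
proof -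
  have "continuous_map (compact_open X) euclideanreal \<phi>"
    using assms by (simp add: dual_Cc_def)
  from openin_continuous_map_preimage[OF this, of "{-1<..<1}"]
  have "openin (compact_open X) {f \<in> Cfun X. \<phi> f \<in> {-1<..<1}}"
    by simp
  also have "{f \<in> Cfun X. \<phi> f \<in> {-1<..<1}} = {f \<in> Cfun X. \<bar>\<phi> f\<bar> < 1}"
    by auto
  finally show "openin (compact_open X) {f \<in> Cfun X. \<bar>\<phi> f\<bar> < 1}" .
  have "\<phi> (\<lambda>x. 0 * f x) = 0 * \<phi> f" if "f \<in> Cfun X" for f
    using assms that unfolding dual_Cc_def mem_Collect_eq by blast
  from this[OF Cfun_zero] have "\<phi> (\<lambda>x. 0) = 0"
    by simp
  then show "(\<lambda>x. 0) \<in> {f \<in> Cfun X. \<bar>\<phi> f\<bar> < 1}"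
    by (simp add: Cfun_zero)
qed

lemma dual_imp_bounded_functional:
  assumes "\<phi> \<in> dual_Cc X"
  obtains K C where "compactin X K" "bounded_functional X K C \<phi>"
proof -
  obtain K e where K: "compactin X K" "e > 0"
    "\<And>f. f \<in> Cfun X \<Longrightarrow> (\<And>x. x \<in> K \<Longrightarrow> \<bar>f x\<bar> < e) \<Longrightarrow> f \<in> {f \<in> Cfun X. \<bar>\<phi> f\<bar> < 1}"
    by (rule compact_open_nhds_zero[OF dual_unit_nhd[OF assms]]) blast
  then have "bounded_functional X K (2 / e) \<phi>"
    by (intro bounded_functional_from_nhd assms) auto
  then show ?thesis using K that by blast
qed

text \<open>Metrizability gives a countable neighbourhood base at 0. Each of its members contains a
  set of functions small on one compact set, and the unit neighbourhood of a functional contains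
  such a member.\<close>

lemma countable_bounding_family:
  assumes "metrizable_space (compact_open X)"
  obtains \<K> where "countable \<K>" "\<And>K. K \<in> \<K> \<Longrightarrow> compactin X K"
    "\<And>\<phi>. \<phi> \<in> dual_Cc X \<Longrightarrow> \<exists>K\<in>\<K>. \<exists>C. bounded_functional X K C \<phi>"
proof -
  define z where "z = (\<lambda>_::'a. 0::real)"
  have z: "z \<in> topspace (compact_open X)"
    by (simp add: z_def Cfun_zero)
  obtain \<B> where \<B>: "countable \<B>" "\<And>V. V \<in> \<B> \<Longrightarrow> openin (compact_open X) V"
    "\<And>U. openin (compact_open X) U \<Longrightarrow> z \<in> U \<Longrightarrow> \<exists>V\<in>\<B>. z \<in> V \<and> V \<subseteq> U"
    using metrizable_imp_first_countable[OF assms] z unfolding first_countable_def by meson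
  define \<B>' where "\<B>' = {V \<in> \<B>. z \<in> V}"
  have "\<exists>K. compactin X K \<and> (\<exists>e>0. \<forall>f\<in>Cfun X. (\<forall>x\<in>K. \<bar>f x\<bar> < e) \<longrightarrow> f \<in> V)" if "V \<in> \<B>'" for V
  proof -
    have "openin (compact_open X) V" "(\<lambda>x. 0) \<in> V"
      using \<B>(2) that by (auto simp: \<B>'_def z_def)
    then show ?thesis
      by (rule compact_open_nhds_zero) blast
  qed
  then have "\<forall>V\<in>\<B>'. \<exists>K. compactin X K \<and> (\<exists>e>0. \<forall>f\<in>Cfun X. (\<forall>x\<in>K. \<bar>f x\<bar> < e) \<longrightarrow> f \<in> V)"
    by blast
  from bchoice[OF this] obtain \<kappa> where \<kappa>: "\<forall>V\<in>\<B>'. compactin X (\<kappa> V) \<and>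
      (\<exists>e>0. \<forall>f\<in>Cfun X. (\<forall>x\<in>\<kappa> V. \<bar>f x\<bar> < e) \<longrightarrow> f \<in> V)"
    by (elim exE)
  show ?thesis
  proof
    show "countable (\<kappa> ` \<B>')"
      using \<B>(1) by (simp add: \<B>'_def)
    show "compactin X K" if "K \<in> \<kappa> ` \<B>'" for K
      using that \<kappa> by blast
    show "\<exists>K\<in>\<kappa> ` \<B>'. \<exists>C. bounded_functional X K C \<phi>" if \<phi>: "\<phi> \<in> dual_Cc X" for \<phi>
    proof -
      have "z \<in> {f \<in> Cfun X. \<bar>\<phi> f\<bar> < 1}"
        unfolding z_def by (rule dual_unit_nhd[OF \<phi>])
      then obtain V where V: "V \<in> \<B>'" "V \<subseteq> {f \<in> Cfun X. \<bar>\<phi> f\<bar> < 1}"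
        using \<B>(3)[OF dual_unit_nhd(1)[OF \<phi>]] by (auto simp: \<B>'_def)
      obtain e where e: "e > 0" "\<forall>f\<in>Cfun X. (\<forall>x\<in>\<kappa> V. \<bar>f x\<bar> < e) \<longrightarrow> f \<in> V"
        using bspec[OF \<kappa> V(1)] by (elim conjE exE)
      have "bounded_functional X (\<kappa> V) (2 / e) \<phi>"
        using e V(2) by (intro bounded_functional_from_nhd \<phi>) auto
      then show ?thesis using V(1) by blast
    qed
  qed
qed

section \<open>The weak topology\<close>

lemma openin_weak_Cc_basic:
  "\<phi> \<in> dual_Cc X \<Longrightarrow> open U \<Longrightarrow> openin (weak_Cc X) {f \<in> Cfun X. \<phi> f \<in> U}"
  unfolding weak_Cc_def by (rule topology_generated_by_Basis) blast

lemma topspace_weak_Cc [simp]: "topspace (weak_Cc X) = Cfun X"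
proof
  have "bounded_functional X {} 0 (\<lambda>f. 0)"
    by (simp add: bounded_functional_def)
  then have "(\<lambda>f. 0) \<in> dual_Cc X"
    by (rule bounded_functional_imp_dual) simp
  from openin_subset[OF openin_weak_Cc_basic[OF this open_UNIV]]
  show "Cfun X \<subseteq> topspace (weak_Cc X)"
    by simp
qed (auto simp: weak_Cc_def)

text \<open>Reduces claims about weakly open sets to preimages under a single functional, plus
  stability under binary intersections and arbitrary unions.\<close>

lemma weak_Cc_induct [consumes 1, case_names Empty Int UN Basis]:
  assumes "openin (weak_Cc X) U"
    and "P {}"
    and "\<And>a b. openin (weak_Cc X) a \<Longrightarrow> P a \<Longrightarrow> openin (weak_Cc X) b \<Longrightarrow> P b \<Longrightarrow> P (a \<inter> b)"
    and "\<And>\<U>. (\<And>a. a \<in> \<U> \<Longrightarrow> openin (weak_Cc X) a) \<Longrightarrow> (\<And>a. a \<in> \<U> \<Longrightarrow> P a) \<Longrightarrow> P (\<Union>\<U>)"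
    and "\<And>\<phi> V. \<phi> \<in> dual_Cc X \<Longrightarrow> open V \<Longrightarrow> P {f \<in> Cfun X. \<phi> f \<in> V}"
  shows "P U"
proof -
  have "generate_topology_on {{f \<in> Cfun X. \<phi> f \<in> V} | \<phi> V. \<phi> \<in> dual_Cc X \<and> open V} U"
    using assms(1) by (simp add: weak_Cc_def openin_topology_generated_by_iff)
  then show ?thesis
    by induction
      (use assms in \<open>auto simp: weak_Cc_def openin_topology_generated_by_iff\<close>)
qed

lemma eval_bounded_functional: "x \<in> K \<Longrightarrow> bounded_functional X K 1 (\<lambda>f. f x)"
  by (auto simp: bounded_functional_def)

lemma eval_in_dual: "x \<in> topspace X \<Longrightarrow> (\<lambda>f. f x) \<in> dual_Cc X"
  by (rule bounded_functional_imp_dual[OF eval_bounded_functional[of x "{x}"]]) auto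

lemma limitin_weak_Cc:
  assumes "l \<in> Cfun X" "\<And>i. s i \<in> Cfun X"
    and lim: "\<And>\<phi>. \<phi> \<in> dual_Cc X \<Longrightarrow> ((\<lambda>i. \<phi> (s i)) \<longlongrightarrow> \<phi> l) F"
  shows "limitin (weak_Cc X) s l F"
proof -
  have "l \<in> U \<longrightarrow> eventually (\<lambda>i. s i \<in> U) F" if "openin (weak_Cc X) U" for U
    using that
  proof (induction rule: weak_Cc_induct)
    case (Int a b)
    then show ?case by (auto simp: eventually_conj_iff)
  next
    case (UN \<U>)
    show ?case
    proof
      assume "l \<in> \<Union>\<U>"
      then obtain a where a: "a \<in> \<U>" "l \<in> a" by blast
      then have "eventually (\<lambda>i. s i \<in> a) F" using UN by blast
      then show "eventually (\<lambda>i. s i \<in> \<Union>\<U>) F"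
        by (rule eventually_mono) (use a in blast)
    qed
  next
    case (Basis \<phi> V)
    then show ?case using topological_tendstoD[OF lim] assms by auto
  qed auto
  then show ?thesis using assms by (auto simp: limitin_def)
qed

text \<open>Closed balls of reals pull back to weakly closed neighbourhoods; having a closed
  neighbourhood inside an open set survives intersections and unions.\<close>

lemma regular_space_weak_Cc: "regular_space (weak_Cc X)"
proof -
  have "f \<in> W \<longrightarrow> (\<exists>U V. openin (weak_Cc X) U \<and> closedin (weak_Cc X) V \<and> f \<in> U \<and> U \<subseteq> V \<and> V \<subseteq> W)"
    if "openin (weak_Cc X) W" for f W
    using that
  proof (induction rule: weak_Cc_induct)
    case (Int a b)
    show ?case
    proof
      assume "f \<in> a \<inter> b"
      then obtain U V U' V' where
        "openin (weak_Cc X) U" "closedin (weak_Cc X) V" "f \<in> U" "U \<subseteq> V" "V \<subseteq> a"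
        "openin (weak_Cc X) U'" "closedin (weak_Cc X) V'" "f \<in> U'" "U' \<subseteq> V'" "V' \<subseteq> b"
        using Int.IH by auto
      then show "\<exists>U V. openin (weak_Cc X) U \<and> closedin (weak_Cc X) V \<and> f \<in> U \<and> U \<subseteq> V \<and> V \<subseteq> a \<inter> b"
        by (intro exI[of _ "U \<inter> U'"] exI[of _ "V \<inter> V'"]) auto
    qed
  next
    case (UN \<U>)
    then show ?case by (metis Union_upper UnionE subset_trans)
  next
    case (Basis \<phi> W)
    show ?case
    proof
      assume f: "f \<in> {f \<in> Cfun X. \<phi> f \<in> W}"
      then obtain e where e: "e > 0" "cball (\<phi> f) e \<subseteq> W"
        using Basis open_contains_cball by blast
      have "closedin (weak_Cc X) {g \<in> Cfun X. \<phi> g \<in> cball (\<phi> f) e}"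
      proof -
        have "Cfun X - {g \<in> Cfun X. \<phi> g \<in> cball (\<phi> f) e} = {g \<in> Cfun X. \<phi> g \<in> - cball (\<phi> f) e}"
          by auto
        then show ?thesis
          using openin_weak_Cc_basic[OF Basis(1) open_Compl[OF closed_cball], of "\<phi> f" e]
          by (simp add: closedin_def)
      qed
      then show "\<exists>U V. openin (weak_Cc X) U \<and> closedin (weak_Cc X) V \<and> f \<in> U \<and> U \<subseteq> V \<and>
          V \<subseteq> {f \<in> Cfun X. \<phi> f \<in> W}"
        using openin_weak_Cc_basic[OF Basis(1), of "ball (\<phi> f) e"] f e
        by (intro exI[of _ "{g \<in> Cfun X. \<phi> g \<in> ball (\<phi> f) e}"]
            exI[of _ "{g \<in> Cfun X. \<phi> g \<in> cball (\<phi> f) e}"]) auto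
    qed
  qed auto
  then show ?thesis
    by (simp add: neighbourhood_base_of neighbourhood_base_of_closedin[symmetric])
qed

section \<open>Weakly \<open>\<aleph>\<close>-spaces\<close>

lemma aleph0_imp_aleph_space:
  assumes "aleph0_space Y"
  shows "aleph_space Y"
proof -
  obtain \<N> where \<N>: "countable \<N>" "k_network Y \<N>" and reg: "regular_space Y"
    using assms by (auto simp: aleph0_space_def)
  \<comment> \<open>One member per level makes every level finite, hence locally finite.
    \<open>from_nat_into\<close> enumerates only nonempty sets, so the empty network is
    separated.\<close>
  define \<M> where "\<M> n = (if \<N> = {} then {} else {from_nat_into \<N> n})" for n
  have "(\<Union>n. \<M> n) = \<N>"
    using range_from_nat_into[OF _ \<N>(1)] by (auto simp: \<M>_def)
  moreover have "locally_finite_in Y (\<M> n)" for n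
  proof -
    have "\<Union>(\<M> n) \<subseteq> topspace Y"
      using \<N>(2) from_nat_into[of \<N> n] by (auto simp: \<M>_def k_network_def)
    moreover have "finite (\<M> n)"
      by (simp add: \<M>_def)
    ultimately show ?thesis
      by (intro finite_imp_locally_finite_in)
  qed
  ultimately show ?thesis
    using reg \<N>(2) unfolding aleph_space_def by metis
qed

section \<open>Sequences of functions with disjoint supports\<close>

text \<open>Iterating \<open>step\<close> gives nested sets: each function vanishes on the next set,
  while all later functions live inside it. \<open>P\<close> expresses what must survive the
  shrinking.\<close>

lemma disjoint_support_sequence:
  fixes G :: "'a set"
  assumes "P G"
    and step: "\<And>G. P G \<Longrightarrow> \<exists>f G'. R f \<and> (\<forall>x. x \<notin> G \<longrightarrow> f x = 0) \<and> P G' \<and> G' \<subseteq> G \<and> (\<forall>x\<in>G'. f x = 0)"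
  shows "\<exists>f :: nat \<Rightarrow> 'a \<Rightarrow> real. (\<forall>i. R (f i) \<and> (\<forall>x. x \<notin> G \<longrightarrow> f i x = 0)) \<and>
    (\<forall>i j x. i \<noteq> j \<longrightarrow> f i x \<noteq> 0 \<longrightarrow> f j x = 0)"
proof -
  have "\<forall>G. \<exists>f G'. P G \<longrightarrow>
      R f \<and> (\<forall>x. x \<notin> G \<longrightarrow> f x = 0) \<and> P G' \<and> G' \<subseteq> G \<and> (\<forall>x\<in>G'. f x = 0)"
    using step by blast
  then obtain F N where FN: "\<And>G. P G \<Longrightarrow>
      R (F G) \<and> (\<forall>x. x \<notin> G \<longrightarrow> F G x = 0) \<and> P (N G) \<and> N G \<subseteq> G \<and> (\<forall>x\<in>N G. F G x = 0)"
    by metis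
  define H where "H n = (N ^^ n) G" for n
  have H: "P (H n)" for n
    by (induction n) (auto simp: H_def FN \<open>P G\<close>)
  have mono: "H n \<subseteq> H m" if "m \<le> n" for m n
    by (rule lift_Suc_antimono_le[OF _ that]) (use FN[OF H] in \<open>simp add: H_def\<close>)
  have less: "F (H j) x = 0" if "i < j" "F (H i) x \<noteq> 0" for i j x
  proof -
    have "x \<notin> H (Suc i)" using FN[OF H[of i]] that(2) by (auto simp: H_def)
    then have "x \<notin> H j" using mono[of "Suc i" j] that(1) by auto
    then show ?thesis using FN[OF H] by blast
  qed
  show ?thesis
  proof (intro exI[of _ "\<lambda>i. F (H i)"] conjI allI impI)
    show "R (F (H i))" for i using FN[OF H] by blast
    show "F (H i) x = 0" if "x \<notin> G" for i x
      using FN[OF H[of i]] mono[of 0 i] that unfolding H_def by auto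
    show "F (H j) x = 0" if "i \<noteq> j" "F (H i) x \<noteq> 0" for i j x
      using less[of i j x] less[of j i x] that by (metis linorder_neqE_nat)
  qed
qed

text \<open>The surviving property is that the open set still contains infinitely many points of
  \<open>S\<close>. Two of these points are separated by a function \<open>u\<close>; one of them
  carries the bump, and infinitely many points remain on the other side.\<close>

lemma disjoint_bumps:
  assumes X: "completely_regular_space X" "Hausdorff_space X"
    and G: "openin X G" and S: "infinite S" "S \<subseteq> G"
  shows "\<exists>f :: nat \<Rightarrow> 'a \<Rightarrow> real. (\<forall>i. (\<exists>a\<in>S. f i a = 1) \<and> f i \<in> Cfun X) \<and>
    (\<forall>i x. 0 \<le> f i x \<and> f i x \<le> 1 \<and> (x \<notin> G \<longrightarrow> f i x = 0)) \<and>
    (\<forall>i j x. i \<noteq> j \<longrightarrow> f i x \<noteq> 0 \<longrightarrow> f j x = 0)"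
proof -
  define R where "R f \<longleftrightarrow> (\<exists>a\<in>S. f a = 1) \<and> f \<in> Cfun X \<and> (\<forall>x. 0 \<le> f x \<and> f x \<le> 1)" for f
  have step: "\<exists>f G'. R f \<and> (\<forall>x. x \<notin> G \<longrightarrow> f x = 0) \<and> (openin X G' \<and> infinite (S \<inter> G')) \<and>
      G' \<subseteq> G \<and> (\<forall>x\<in>G'. f x = 0)"
    if G: "openin X G \<and> infinite (S \<inter> G)" for G
  proof -
    from G have G: "openin X G" and inf: "infinite (S \<inter> G)" by auto
    obtain a where a: "a \<in> S \<inter> G" using inf by (metis finite.emptyI equals0I)
    obtain b where b: "b \<in> S \<inter> G" "b \<noteq> a"
      using inf by (metis finite.emptyI finite_insert insertI1 subsetI finite_subset)
    have GX: "G \<subseteq> topspace X" by (rule openin_subset[OF G])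
    have "openin X (topspace X - {b})"
      using b GX closedin_Hausdorff_singleton[OF X(2)] by blast
    then obtain u where u: "u \<in> Cfun X" "u a = 1" "\<And>x. 0 \<le> u x" "\<And>x. u x \<le> 1" "u b = 0"
      using Cfun_bump[OF X(1), of "topspace X - {b}" a] a b GX by (metis DiffE DiffI IntD2 singletonD singletonI subsetD)
    \<comment> \<open>These two open sets overlap and cover the space, so one of them keeps
      infinitely many points of \<open>S\<close>.\<close>
    define P where "P = {x \<in> topspace X. u x \<in> {..<2/3}}"
    define Q where "Q = {x \<in> topspace X. u x \<in> {1/3<..}}"
    have op: "openin X P" "openin X Q"
      unfolding P_def Q_def by (intro openin_Cfun_vimage u open_lessThan open_greaterThan)+
    have "S \<inter> G \<subseteq> (S \<inter> (G \<inter> P)) \<union> (S \<inter> (G \<inter> Q))"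
      using GX by (auto simp: P_def Q_def)
    then consider "infinite (S \<inter> (G \<inter> P))" | "infinite (S \<inter> (G \<inter> Q))"
      using inf finite_subset by blast
    then show ?thesis
    proof cases
      case 1
      obtain v where v: "v \<in> Cfun X" "v a = 1" "\<And>x. 0 \<le> v x" "\<And>x. v x \<le> 1" "\<And>x. x \<notin> G \<Longrightarrow> v x = 0"
        using Cfun_bump[OF X(1) G] a by (metis IntD2)
      \<comment> \<open>The second factor is 1 at \<open>a\<close> and vanishes on \<open>P\<close>;
        \<open>v\<close> confines the bump to \<open>G\<close>.\<close>
      have "(\<lambda>x. v x * max 0 (3 * u x - 2)) \<in> Cfun X"
        using u(1) by (intro Cfun_mult v) (auto simp: Cfun_def intro!: continuous_map_real_max continuous_map_diff continuous_map_real_mult)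
      then show ?thesis
        using 1 v u a op G
        by (intro exI[of _ "\<lambda>x. v x * max 0 (3 * u x - 2)"] exI[of _ "G \<inter> P"])
          (auto simp: R_def P_def intro!: mult_le_one bexI[of _ a])
    next
      case 2
      obtain v where v: "v \<in> Cfun X" "v b = 1" "\<And>x. 0 \<le> v x" "\<And>x. v x \<le> 1" "\<And>x. x \<notin> G \<Longrightarrow> v x = 0"
        using Cfun_bump[OF X(1) G] b by (metis IntD2)
      \<comment> \<open>Symmetrically, 1 at \<open>b\<close> and 0 on \<open>Q\<close>.\<close>
      have "(\<lambda>x. v x * max 0 (1 - 3 * u x)) \<in> Cfun X"
        using u(1) by (intro Cfun_mult v) (auto simp: Cfun_def intro!: continuous_map_real_max continuous_map_diff continuous_map_real_mult)
      then show ?thesis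
        using 2 v u b op G
        by (intro exI[of _ "\<lambda>x. v x * max 0 (1 - 3 * u x)"] exI[of _ "G \<inter> Q"])
          (auto simp: R_def Q_def intro!: mult_le_one bexI[of _ b])
    qed
  qed
  have "openin X G \<and> infinite (S \<inter> G)"
    using G S by (simp add: inf_absorb1)
  then have "\<exists>f :: nat \<Rightarrow> 'a \<Rightarrow> real. (\<forall>i. R (f i) \<and> (\<forall>y. y \<notin> G \<longrightarrow> f i y = 0)) \<and>
      (\<forall>i j y. i \<noteq> j \<longrightarrow> f i y \<noteq> 0 \<longrightarrow> f j y = 0)"
    by (rule disjoint_support_sequence[where P = "\<lambda>G. openin X G \<and> infinite (S \<inter> G)"]) (rule step)
  then obtain f :: "nat \<Rightarrow> 'a \<Rightarrow> real" where "\<forall>i. R (f i) \<and> (\<forall>x. x \<notin> G \<longrightarrow> f i x = 0)"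
    "\<forall>i j x. i \<noteq> j \<longrightarrow> f i x \<noteq> 0 \<longrightarrow> f j x = 0"
    by (elim exE conjE)
  then show ?thesis
    unfolding R_def by (intro exI[of _ f]) blast
qed

lemma distinct_representatives:
  assumes "\<And>n::nat. infinite (A n)"
  obtains s where "\<And>n. s n \<in> A n" "inj s"
proof -
  \<comment> \<open>The state is a pair: the finite set of points used so far and the latest
    choice.\<close>
  have "\<exists>S. \<forall>n. (finite (fst (S n)) \<and> snd (S n) \<in> A n \<and> snd (S n) \<in> fst (S n)) \<and>
      (fst (S n) \<subseteq> fst (S (Suc n)) \<and> snd (S (Suc n)) \<notin> fst (S n))"
  proof (rule dependent_nat_choice)
    obtain x where "x \<in> A 0" using assms[of 0] by (metis finite.emptyI equals0I)
    then show "\<exists>S. finite (fst S) \<and> snd S \<in> A 0 \<and> snd S \<in> fst S"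
      by (intro exI[of _ "({x}, x)"]) auto
  next
    fix S :: "'a set \<times> 'a" and n
    assume S: "finite (fst S) \<and> snd S \<in> A n \<and> snd S \<in> fst S"
    then obtain x where "x \<in> A (Suc n)" "x \<notin> fst S"
      using assms[of "Suc n"] by (meson finite_subset subsetI)
    then show "\<exists>S'. (finite (fst S') \<and> snd S' \<in> A (Suc n) \<and> snd S' \<in> fst S') \<and>
        (fst S \<subseteq> fst S' \<and> snd S' \<notin> fst S)"
      using S by (intro exI[of _ "(insert x (fst S), x)"]) auto
  qed
  then obtain S where S: "\<And>n. snd (S n) \<in> A n" "\<And>n. snd (S n) \<in> fst (S n)"
    "\<And>n. fst (S n) \<subseteq> fst (S (Suc n))" "\<And>n. snd (S (Suc n)) \<notin> fst (S n)"
    by blast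
  have mono: "fst (S m) \<subseteq> fst (S n)" if "m \<le> n" for m n
    by (rule lift_Suc_mono_le[of "\<lambda>n. fst (S n)", OF _ that]) (rule S(3))
  have "snd (S m) \<noteq> snd (S n)" if "m < n" for m n
  proof -
    obtain k where k: "n = Suc k" "m \<le> k" using \<open>m < n\<close> less_iff_Suc_add by auto
    then have "snd (S m) \<in> fst (S k)" using S(2) mono by blast
    then show ?thesis using S(4)[of k] k by auto
  qed
  then have "inj (\<lambda>n. snd (S n))"
    by (metis injI linorder_neqE_nat)
  then show ?thesis using that[of "\<lambda>n. snd (S n)"] S(1) by blast
qed

section \<open>From a \<open>\<sigma>\<close>-locally finite k-network to countability\<close>

lemma weakly_aleph_imp_countable:
  assumes X: "completely_regular_space X" "Hausdorff_space X"
    and aleph: "aleph_space (weak_Cc X)"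
  shows "countable (topspace X)"
proof -
  obtain \<N> where lf: "\<And>n::nat. locally_finite_in (weak_Cc X) (\<N> n)"
    and kn: "k_network (weak_Cc X) (\<Union>n. \<N> n)"
    using aleph by (auto simp: aleph_space_def)
  define z where "z = (\<lambda>_::'a. 0::real)"
  have z: "z \<in> Cfun X" by (simp add: z_def Cfun_zero)
  define \<N>0 where "\<N>0 = {M \<in> (\<Union>n. \<N> n). z \<in> weak_Cc X closure_of M}"
  have "finite {M \<in> \<N> n. z \<in> weak_Cc X closure_of M}" for n
  proof -
    obtain V where V: "openin (weak_Cc X) V" "z \<in> V" "finite {M \<in> \<N> n. M \<inter> V \<noteq> {}}"
      using lf[of n] z by (auto simp: locally_finite_in_def)
    then have "{M \<in> \<N> n. z \<in> weak_Cc X closure_of M} \<subseteq> {M \<in> \<N> n. M \<inter> V \<noteq> {}}"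
      by (auto simp: in_closure_of)
    then show ?thesis using V(3) finite_subset by blast
  qed
  then have "countable (\<Union>n. {M \<in> \<N> n. z \<in> weak_Cc X closure_of M})"
    by (auto intro: countable_finite)
  moreover have "\<N>0 = (\<Union>n. {M \<in> \<N> n. z \<in> weak_Cc X closure_of M})"
    by (auto simp: \<N>0_def)
  ultimately have N0: "countable \<N>0" by simp
  define \<G> where "\<G> = Union ` {\<F>. \<F> \<subseteq> \<N>0 \<and> finite \<F>}"
  have countable_G: "countable \<G>"
    unfolding \<G>_def using countable_Collect_finite_subset[OF N0] by (simp add: conj_commute)
  have G_Un: "G \<union> G' \<in> \<G>" if "G \<in> \<G>" "G' \<in> \<G>" for G G'
  proof -
    obtain \<F> \<F>' where "G = \<Union>\<F>" "G' = \<Union>\<F>'" "\<F> \<union> \<F>' \<in> {\<F>. \<F> \<subseteq> \<N>0 \<and> finite \<F>}"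
      using \<open>G \<in> \<G>\<close> \<open>G' \<in> \<G>\<close> by (auto simp: \<G>_def)
    then show ?thesis
      unfolding \<G>_def by (intro image_eqI[of _ _ "\<F> \<union> \<F>'"]) auto
  qed
  define T where "T G = {t \<in> topspace X. \<forall>h\<in>G. \<bar>h t\<bar> < 1}" for G :: "('a \<Rightarrow> real) set"
  have fin: "\<exists>G\<in>\<G>. t \<in> T G \<and> finite (T G)" if t: "t \<in> topspace X" for t
  proof (rule ccontr)
    assume "\<not> ?thesis"
    then have inf: "infinite (T G)" if "G \<in> \<G>" "t \<in> T G" for G
      using that by blast
    define \<G>t where "\<G>t = {G \<in> \<G>. t \<in> T G}"
    \<comment> \<open>The empty union has \<open>T {} = topspace X\<close>, so there is something to
      enumerate.\<close>
    have "{} \<in> \<G>t"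
      using t by (auto simp: \<G>t_def \<G>_def T_def)
    then have ne: "\<G>t \<noteq> {}" by blast
    define g where "g = from_nat_into \<G>t"
    have g: "range g = \<G>t"
      unfolding g_def by (rule range_from_nat_into[OF ne]) (simp add: \<G>t_def countable_G)
    \<comment> \<open>Cumulative unions: a function outside \<open>M n\<close> avoids every
      \<open>g m\<close> with \<open>m \<le> n\<close> at once.\<close>
    define M where "M n = (\<Union>i\<le>n. g i)" for n
    have M: "M n \<in> \<G>t" for n
    proof (induction n)
      case 0
      then show ?case using g by (auto simp: M_def)
    next
      case (Suc n)
      have "M (Suc n) = M n \<union> g (Suc n)"
        by (auto simp: M_def le_Suc_eq)
      moreover have "g (Suc n) \<in> \<G>t" using g by blast
      ultimately show ?case using Suc G_Un by (auto simp: \<G>t_def T_def)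
    qed
    \<comment> \<open>Dropping \<open>t\<close> lets all bumps vanish at \<open>t\<close>, as
      membership in \<open>U\<close> below requires.\<close>
    have "infinite (T (M n) - {t})" for n
      using inf M[of n] by (simp add: \<G>t_def)
    then obtain s where s: "\<And>n. s n \<in> T (M n) - {t}" "inj s"
      using distinct_representatives[of "\<lambda>n. T (M n) - {t}"] by blast
    have G: "openin X (topspace X - {t})"
      using closedin_Hausdorff_singleton[OF X(2) t] by blast
    have "infinite (range s)" "range s \<subseteq> topspace X - {t}"
      using s range_inj_infinite by (auto simp: T_def)
    from disjoint_bumps[OF X G this] obtain f :: "nat \<Rightarrow> 'a \<Rightarrow> real" where
      *: "\<forall>i. (\<exists>a\<in>range s. f i a = 1) \<and> f i \<in> Cfun X"
        "\<forall>i x. 0 \<le> f i x \<and> f i x \<le> 1 \<and> (x \<notin> topspace X - {t} \<longrightarrow> f i x = 0)"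
      and disj: "\<forall>i j x. i \<noteq> j \<longrightarrow> f i x \<noteq> 0 \<longrightarrow> f j x = 0"
      by (elim exE conjE)
    have f: "\<And>i. f i \<in> Cfun X" "\<And>i x. 0 \<le> f i x" "\<And>i x. f i x \<le> 1" "\<And>i. f i t = 0"
      using * by auto
    from *(1) have "\<forall>i. \<exists>n. f i (s n) = 1" by blast
    then obtain k where k: "\<And>i. f i (s (k i)) = 1" by metis
    \<comment> \<open>Two bumps equal to 1 at the same point would violate disjointness of
      supports.\<close>
    have "inj k"
    proof (rule injI, rule ccontr)
      fix i j assume "k i = k j" "i \<noteq> j"
      then show False using k[of i] k[of j] \<open>i \<noteq> j\<close> disj by fastforce
    qed
    \<comment> \<open>All members of \<open>M (k i)\<close> are below 1 in absolute value at
      \<open>s (k i)\<close>, where \<open>f i\<close> equals 1.\<close>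
    have notin: "f i \<notin> M (k i)" for i
      using s(1)[of "k i"] k[of i] by (auto simp: T_def)
    have lim: "limitin (weak_Cc X) f z sequentially"
    proof (rule limitin_weak_Cc[OF z f(1)])
      fix \<phi> assume "\<phi> \<in> dual_Cc X"
      then obtain K C where \<phi>: "bounded_functional X K C \<phi>"
        by (rule dual_imp_bounded_functional)
      have "(\<lambda>i. \<phi> (f i)) \<longlonglongrightarrow> 0"
        by (rule bounded_functional_disjoint_tendsto_0[OF \<phi> f(1)])
          (use f(2,3) disj in \<open>simp_all add: abs_of_nonneg\<close>)
      then show "(\<lambda>i. \<phi> (f i)) \<longlonglongrightarrow> \<phi> z"
        using bounded_functional_zero[OF \<phi>] by (simp add: z_def)
    qed
    define U where "U = {h \<in> Cfun X. h t \<in> {-1<..<1}}"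
    have "openin (weak_Cc X) U"
      unfolding U_def using openin_weak_Cc_basic[OF eval_in_dual[OF t], of "{-1<..<1}"] by simp
    moreover have "compactin (weak_Cc X) (insert z (range f))"
      by (rule compactin_sequence_with_limit[OF lim]) (use f(1) in auto)
    moreover have "insert z (range f) \<subseteq> U"
      using z f(1) f(4) by (auto simp: U_def z_def)
    ultimately obtain \<F> where \<F>: "finite \<F>" "\<F> \<subseteq> (\<Union>n. \<N> n)" "insert z (range f) \<subseteq> \<Union>\<F>" "\<Union>\<F> \<subseteq> U"
      using kn unfolding k_network_def by meson
    \<comment> \<open>The remaining members of the cover do not have \<open>z\<close> in their
      closure, so the convergent sequence eventually leaves them and must lie in the union of
      \<open>\<F>0\<close>.\<close>
    define \<F>0 where "\<F>0 = \<F> \<inter> \<N>0"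
    have "\<Union>\<F>0 \<in> \<G>"
      using \<F>(1) by (auto simp: \<G>_def \<F>0_def)
    moreover have "t \<in> T (\<Union>\<F>0)"
      using \<F>(4) t by (fastforce simp: T_def \<F>0_def U_def)
    ultimately obtain m where m: "\<Union>\<F>0 = g m"
      using g unfolding \<G>t_def by (metis (mono_tags, lifting) imageE mem_Collect_eq)
    have "eventually (\<lambda>i. f i \<notin> N) sequentially" if "N \<in> \<F> - \<F>0" for N
    proof -
      have "z \<notin> weak_Cc X closure_of N"
        using that \<F>(2) by (auto simp: \<F>0_def \<N>0_def)
      then obtain V where V: "openin (weak_Cc X) V" "z \<in> V" "N \<inter> V = {}"
        using z by (auto simp: in_closure_of)
      then have "eventually (\<lambda>i. f i \<in> V) sequentially"
        using lim by (auto simp: limitin_def)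
      then show ?thesis by (rule eventually_mono) (use V in blast)
    qed
    then have "eventually (\<lambda>i. \<forall>N\<in>\<F> - \<F>0. f i \<notin> N) sequentially"
      using \<F>(1) by (intro eventually_ball_finite) auto
    then obtain i0 where "\<forall>i\<ge>i0. \<forall>N\<in>\<F> - \<F>0. f i \<notin> N"
      unfolding eventually_sequentially by (elim exE)
    moreover have "f i \<in> \<Union>\<F>" for i
      using \<F>(3) by auto
    ultimately have i0: "f i \<in> \<Union>\<F>0" if "i \<ge> i0" for i
      using that by (metis DiffI UnionE UnionI)
    \<comment> \<open>Injectivity of \<open>k\<close> yields a late index \<open>i\<close> with
      \<open>m \<le> k i\<close>, where \<open>g m\<close> is part of
      \<open>M (k i)\<close>.\<close>
    have "infinite (k ` {i0..})"
      using \<open>inj k\<close> by (simp add: finite_image_iff inj_on_subset infinite_Ici)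
    then have "\<not> k ` {i0..} \<subseteq> {..<m}"
      using finite_subset by blast
    then obtain i where i: "i \<ge> i0" "m \<le> k i" by fastforce
    have "f i \<in> g m" using i0[OF i(1)] m by simp
    then have "f i \<in> M (k i)" using i(2) by (auto simp: M_def)
    then show False using notin by blast
  qed
  have "topspace X \<subseteq> (\<Union>G\<in>{G \<in> \<G>. finite (T G)}. T G)"
    using fin by blast
  moreover have "countable (\<Union>G\<in>{G \<in> \<G>. finite (T G)}. T G)"
    using countable_G by (intro countable_UN) (auto intro: countable_finite)
  ultimately show ?thesis
    by (rule countable_subset)
qed

section \<open>Countable spaces\<close>

lemma continuous_map_weak_Cc: "\<phi> \<in> dual_Cc X \<Longrightarrow> continuous_map (weak_Cc X) euclideanreal \<phi>"
  by (auto simp: continuous_map_def openin_weak_Cc_basic)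

section \<open>Weakly compact sets are bounded on compact sets\<close>

lemma Cfun_attains_max_abs:
  assumes "f \<in> Cfun X" "compactin X K" "K \<noteq> {}"
  obtains x where "x \<in> K" "\<And>y. y \<in> K \<Longrightarrow> \<bar>f y\<bar> \<le> \<bar>f x\<bar>"
proof -
  have "continuous_map X euclideanreal (\<lambda>x. \<bar>f x\<bar>)"
    by (intro continuous_map_real_abs Cfun_continuous_map assms)
  from image_compactin[OF assms(2) this] have "compact ((\<lambda>x. \<bar>f x\<bar>) ` K)"
    by simp
  from compact_attains_sup[OF this] assms(3) show ?thesis
    using that by auto
qed

text \<open>Uniform boundedness following Sokal: a series of signed point evaluations with coefficients
  \<open>3\<^sup>-\<^sup>n\<close> is unbounded
  along any sequence whose \<open>n\<close>-th member has supremum norm at least \<open>4\<^sup>n\<close> on \<open>K\<close>, for suitable signs.\<close>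

lemma weakly_compact_imp_bounded:
  assumes A: "compactin (weak_Cc X) A" and K: "compactin X K"
  shows "\<exists>b. \<forall>f\<in>A. \<forall>x\<in>K. \<bar>f x\<bar> \<le> b"
proof (rule ccontr)
  assume unb: "\<not> ?thesis"
  then have "K \<noteq> {}" by blast
  have AC: "A \<subseteq> Cfun X"
    using compactin_subset_topspace[OF A] by simp
  have "\<exists>f x. f \<in> A \<and> x \<in> K \<and> 4 ^ n \<le> \<bar>f x\<bar> \<and> (\<forall>y\<in>K. \<bar>f y\<bar> \<le> \<bar>f x\<bar>)" for n :: nat
  proof -
    obtain f y where f: "f \<in> A" "y \<in> K" "\<bar>f y\<bar> > 4 ^ n"
      using unb by (meson not_le)
    obtain x where "x \<in> K" "\<And>y. y \<in> K \<Longrightarrow> \<bar>f y\<bar> \<le> \<bar>f x\<bar>"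
      using Cfun_attains_max_abs[OF _ K \<open>K \<noteq> {}\<close>, of f] f(1) AC by blast
    then show ?thesis using f by fastforce
  qed
  then obtain F x where F: "\<And>n::nat. F n \<in> A" and x: "\<And>n. x n \<in> K"
    and big: "\<And>n. 4 ^ n \<le> \<bar>F n (x n)\<bar>" and max: "\<And>n y. y \<in> K \<Longrightarrow> \<bar>F n y\<bar> \<le> \<bar>F n (x n)\<bar>"
    by metis
  \<comment> \<open>Since \<open>\<bar>p + h\<bar> + \<bar>p - h\<bar> \<ge> 2 *
    \<bar>h\<bar>\<close>, one of the two signs makes the new partial sum at least as large as the
    added term.\<close>
  define \<epsilon> where "\<epsilon> n p = (if \<bar>F n (x n)\<bar> * (1/3) ^ n \<le> \<bar>p + F n (x n) * (1/3) ^ n\<bar> then 1 else -1 :: real)"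
    for n p
  \<comment> \<open>Recursion over whole functionals, because the n-th sign depends on the value of
    the n-th partial sum at \<open>F n\<close>.\<close>
  define P :: "nat \<Rightarrow> ('a \<Rightarrow> real) \<Rightarrow> real"
    where "P = rec_nat (\<lambda>_. 0) (\<lambda>n p f. p f + \<epsilon> n (p (F n)) * (1/3) ^ n * f (x n))"
  define e where "e n = \<epsilon> n (P n (F n))" for n
  have P_Suc: "P (Suc n) f = P n f + e n * (1/3) ^ n * f (x n)" for n f
    by (simp add: P_def e_def)
  have P: "P n f = (\<Sum>i<n. e i * (1/3) ^ i * f (x i))" for n f
  proof (induction n)
    case 0
    then show ?case by (simp add: P_def)
  qed (simp add: P_Suc)
  have e: "\<bar>e n\<bar> = 1" for n
    by (simp add: e_def \<epsilon>_def)
  have P_large: "\<bar>F n (x n)\<bar> * (1/3) ^ n \<le> \<bar>P (Suc n) (F n)\<bar>" for n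
  proof -
    define h where "h = F n (x n) * (1/3) ^ n"
    define p where "p = P n (F n)"
    have "\<bar>F n (x n)\<bar> * (1/3) ^ n = \<bar>h\<bar>"
      by (simp add: h_def abs_mult)
    moreover have "P (Suc n) (F n) = p + e n * h"
      by (simp add: P_Suc p_def h_def)
    moreover have "e n = (if \<bar>h\<bar> \<le> \<bar>p + h\<bar> then 1 else -1)"
      using calculation(1) by (simp add: e_def \<epsilon>_def p_def h_def)
    ultimately show ?thesis by auto
  qed
  define \<phi> where "\<phi> f = (\<Sum>i. e i * (1/3) ^ i * f (x i))" for f
  have geo: "(\<lambda>i. (1/3) ^ (i + n) * b) sums ((1/3) ^ n * (3/2) * b)" for n and b :: real
    using sums_mult2[OF geometric_sums[of "1/3 :: real"], of "(1/3) ^ n * b"]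
    by (simp add: power_add mult_ac)
  have term_le: "\<bar>e i * (1/3) ^ i * f (x i)\<bar> \<le> (1/3) ^ i * b" if "\<And>y. y \<in> K \<Longrightarrow> \<bar>f y\<bar> \<le> b" for i b f
    using that[OF x[of i]] by (simp add: abs_mult e)
  have summable: "summable (\<lambda>i. e i * (1/3) ^ i * f (x i))" if f: "f \<in> Cfun X" for f
  proof -
    obtain y where y: "y \<in> K" "\<And>z. z \<in> K \<Longrightarrow> \<bar>f z\<bar> \<le> \<bar>f y\<bar>"
      using Cfun_attains_max_abs[OF f K \<open>K \<noteq> {}\<close>] by blast
    show ?thesis
      by (rule summable_comparison_test'[OF sums_summable[OF geo[of 0 "\<bar>f y\<bar>"]], of 0])
        (use term_le[OF y(2)] in simp)
  qed
  have tail: "\<bar>\<Sum>i. e (i + n) * (1/3) ^ (i + n) * f (x (i + n))\<bar> \<le> (1/3) ^ n * (3/2) * b"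
    if f: "f \<in> Cfun X" and b: "\<And>y. y \<in> K \<Longrightarrow> \<bar>f y\<bar> \<le> b" for f n b
  proof -
    have "summable (\<lambda>i. \<bar>e (i + n) * (1/3) ^ (i + n) * f (x (i + n))\<bar>)"
      by (rule summable_comparison_test'[OF sums_summable[OF geo[of n b]], of 0])
        (use term_le[OF b] in simp)
    then have "\<bar>\<Sum>i. e (i + n) * (1/3) ^ (i + n) * f (x (i + n))\<bar>
        \<le> (\<Sum>i. \<bar>e (i + n) * (1/3) ^ (i + n) * f (x (i + n))\<bar>)"
      by (rule summable_rabs)
    also have "\<dots> \<le> (\<Sum>i. (1/3) ^ (i + n) * b)"
      by (rule suminf_le) (use term_le[OF b] \<open>summable _\<close> sums_summable[OF geo[of n b]] in auto)
    also have "\<dots> = (1/3) ^ n * (3/2) * b"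
      using sums_unique[OF geo[of n b]] by simp
    finally show ?thesis .
  qed
  have "bounded_functional X K (3/2) \<phi>"
    unfolding bounded_functional_def
  proof (intro conjI ballI allI impI)
    fix f g assume "f \<in> Cfun X" "g \<in> Cfun X"
    then show "\<phi> (\<lambda>x. f x + g x) = \<phi> f + \<phi> g"
      unfolding \<phi>_def using suminf_add[OF summable summable, of f g] by (simp add: distrib_left)
  next
    fix f c assume "f \<in> Cfun X"
    then show "\<phi> (\<lambda>x. c * f x) = c * \<phi> f"
      unfolding \<phi>_def using suminf_mult[OF summable, of f c] by (simp add: mult_ac)
  next
    fix f b assume "f \<in> Cfun X" "\<forall>x\<in>K. \<bar>f x\<bar> \<le> b"
    then show "\<bar>\<phi> f\<bar> \<le> 3/2 * b"
      using tail[of f b 0] by (simp add: \<phi>_def)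
  qed simp
  then have "\<phi> \<in> dual_Cc X"
    using K by (rule bounded_functional_imp_dual)
  from image_compactin[OF A continuous_map_weak_Cc[OF this]] have "compact (\<phi> ` A)"
    by simp
  then obtain B where B: "\<And>f. f \<in> A \<Longrightarrow> \<bar>\<phi> f\<bar> \<le> B"
    using compact_imp_bounded[of "\<phi> ` A"] by (auto simp: bounded_iff)
  have "(4/3) ^ n \<le> 2 * B" for n
  proof -
    define M where "M = \<bar>F n (x n)\<bar> * (1/3) ^ n"
    have "F n \<in> Cfun X" using F AC by blast
    have "\<phi> (F n) = (\<Sum>i. e (i + Suc n) * (1/3) ^ (i + Suc n) * F n (x (i + Suc n))) + P (Suc n) (F n)"
      unfolding \<phi>_def P by (rule suminf_split_initial_segment[OF summable[OF \<open>F n \<in> Cfun X\<close>]])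
    \<comment> \<open>The tail after the n-th term has total weight
      \<open>(1/3) ^ Suc n * (3/2)\<close>, half of the n-th weight, and \<open>F n\<close> is
      largest on \<open>K\<close> at \<open>x n\<close>. So at least half of \<open>M\<close>
      survives in \<open>\<phi> (F n)\<close>.\<close>
    moreover have "\<bar>\<Sum>i. e (i + Suc n) * (1/3) ^ (i + Suc n) * F n (x (i + Suc n))\<bar> \<le> M / 2"
      using tail[OF \<open>F n \<in> Cfun X\<close> max, of "Suc n"] by (simp add: M_def mult_ac)
    moreover have "M \<le> \<bar>P (Suc n) (F n)\<bar>"
      using P_large by (simp add: M_def)
    ultimately have "M \<le> 2 * \<bar>\<phi> (F n)\<bar>" by linarith
    also have "\<dots> \<le> 2 * B" using B[OF F[of n]] by simp
    finally have "M \<le> 2 * B" .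
    moreover have "4 ^ n * (1/3) ^ n \<le> M"
      unfolding M_def by (intro mult_right_mono big) auto
    ultimately show ?thesis by (simp add: power_mult_distrib[symmetric])
  qed
  moreover obtain n where "2 * B < (4/3) ^ n"
    using real_arch_pow[of "4/3" "2 * B"] by auto
  ultimately show False by (meson not_le)
qed

text \<open>A functional that kept large values on functions vanishing at \<open>x\<close> and supported in arbitrarily
  small neighbourhoods of \<open>x\<close> would do so on a sequence with disjoint supports.\<close>

lemma bounded_functional_small_near_point:
  assumes \<phi>: "bounded_functional X K C \<phi>" and x: "x \<in> topspace X" and e: "e > 0"
  shows "\<exists>U. openin X U \<and> x \<in> U \<and>
    (\<forall>f\<in>Cfun X. (\<forall>y. \<bar>f y\<bar> \<le> 1 \<and> (y \<notin> U \<longrightarrow> f y = 0)) \<longrightarrow> f x = 0 \<longrightarrow> \<bar>\<phi> f\<bar> \<le> e)"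
proof (rule ccontr)
  assume "\<not> ?thesis"
  then have large: "\<exists>f\<in>Cfun X. (\<forall>y. \<bar>f y\<bar> \<le> 1 \<and> (y \<notin> U \<longrightarrow> f y = 0)) \<and> f x = 0 \<and> \<bar>\<phi> f\<bar> > e"
    if "openin X U" "x \<in> U" for U
    using that by (meson not_le)
  define R where "R f \<longleftrightarrow> f \<in> Cfun X \<and> (\<forall>y. \<bar>f y\<bar> \<le> 1) \<and> e / 2 \<le> \<bar>\<phi> f\<bar>" for f
  have C: "C \<ge> 0" by (rule bounded_functional_nonneg[OF \<phi>])
  define d where "d = e / (2 * (C + 1))"
  have d: "d > 0" "C * d \<le> e / 2"
    using e C by (auto simp: d_def field_simps)
  have step: "\<exists>f U'. R f \<and> (\<forall>y. y \<notin> U \<longrightarrow> f y = 0) \<and> (openin X U' \<and> x \<in> U') \<and> U' \<subseteq> U \<and> (\<forall>y\<in>U'. f y = 0)"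
    if U: "openin X U \<and> x \<in> U" for U
  proof -
    obtain f where f: "f \<in> Cfun X" "\<forall>y. \<bar>f y\<bar> \<le> 1 \<and> (y \<notin> U \<longrightarrow> f y = 0)" "f x = 0" "\<bar>\<phi> f\<bar> > e"
      using large U by blast
    \<comment> \<open>Clipping at level \<open>d\<close> costs at most
      \<open>C * d \<le> e / 2\<close>. The rest \<open>g\<close> vanishes wherever
      \<open>\<bar>f y\<bar> < d\<close>, which includes a neighbourhood of \<open>x\<close> because
      \<open>f x = 0\<close>.\<close>
    define c where "c = (\<lambda>y. max (- d) (min d (f y)))"
    have c: "c \<in> Cfun X" unfolding c_def using f d by (intro Cfun_clip) auto
    have "\<bar>\<phi> c\<bar> \<le> C * d"
      using d by (intro bounded_functional_bound[OF \<phi> c]) (auto simp: c_def)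
    define g where "g = (\<lambda>y. f y - c y)"
    define V where "V = U \<inter> {y \<in> topspace X. f y \<in> {-d<..<d}}"
    have "\<phi> g = \<phi> f - \<phi> c"
      unfolding g_def by (rule bounded_functional_diff[OF \<phi> f(1) c])
    then have "e / 2 \<le> \<bar>\<phi> g\<bar>"
      using f(4) d(2) \<open>\<bar>\<phi> c\<bar> \<le> C * d\<close> by linarith
    moreover have "\<bar>g y\<bar> \<le> 1" for y
      using f(2)[rule_format, of y] d(1)
      by (auto simp: g_def c_def max_def min_def abs_if split: if_splits)
    moreover have "g \<in> Cfun X"
      unfolding g_def by (rule Cfun_diff[OF f(1) c])
    ultimately have "R g"
      by (simp add: R_def)
    moreover have "openin X V"
      unfolding V_def using U f by (intro openin_Int openin_Cfun_vimage) auto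
    moreover have "x \<in> V"
      using U f x d by (auto simp: V_def)
    moreover have "\<forall>y. y \<notin> U \<longrightarrow> g y = 0"
      using f(2) d by (simp add: g_def c_def)
    moreover have "\<forall>y\<in>V. g y = 0"
      by (simp add: V_def g_def c_def)
    moreover have "V \<subseteq> U"
      by (simp add: V_def)
    ultimately show ?thesis
      by (intro exI[of _ g] exI[of _ V] conjI)
  qed
  have "openin X (topspace X) \<and> x \<in> topspace X"
    using x by simp
  then have "\<exists>f :: nat \<Rightarrow> 'a \<Rightarrow> real. (\<forall>i. R (f i) \<and> (\<forall>y. y \<notin> topspace X \<longrightarrow> f i y = 0)) \<and>
      (\<forall>i j y. i \<noteq> j \<longrightarrow> f i y \<noteq> 0 \<longrightarrow> f j y = 0)"
    by (rule disjoint_support_sequence[where P = "\<lambda>U. openin X U \<and> x \<in> U"]) (rule step)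
  then obtain f :: "nat \<Rightarrow> 'a \<Rightarrow> real" where f: "\<forall>i. R (f i) \<and> (\<forall>y. y \<notin> topspace X \<longrightarrow> f i y = 0)"
    "\<forall>i j y. i \<noteq> j \<longrightarrow> f i y \<noteq> 0 \<longrightarrow> f j y = 0"
    by (elim exE conjE)
  have "(\<lambda>i. \<phi> (f i)) \<longlonglongrightarrow> 0"
    by (rule bounded_functional_disjoint_tendsto_0[OF \<phi>]) (use f in \<open>simp_all add: R_def\<close>)
  from tendstoD[OF this half_gt_zero[OF e]]
  have "eventually (\<lambda>i. \<bar>\<phi> (f i)\<bar> < e / 2) sequentially"
    by (simp only: dist_real_def diff_0_right)
  then obtain i where "\<bar>\<phi> (f i)\<bar> < e / 2"
    using eventually_happens'[OF sequentially_bot] by blast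
  then show False using f(1) by (auto simp: R_def not_less[symmetric])
qed

text \<open>Subtracting \<open>f x\<close> times a fixed bump \<open>u\<close> at \<open>x\<close>
  leaves a function vanishing at \<open>x\<close>, to which the previous lemma applies; the constant
  is \<open>c = \<phi> u\<close>.\<close>

lemma bounded_functional_near_point:
  assumes X: "completely_regular_space X"
    and \<phi>: "bounded_functional X K C \<phi>" and x: "x \<in> topspace X" and e: "e > 0"
  obtains U c where "openin X U" "x \<in> U"
    "\<And>f. f \<in> Cfun X \<Longrightarrow> \<forall>y. \<bar>f y\<bar> \<le> 1 \<and> (y \<notin> U \<longrightarrow> f y = 0) \<Longrightarrow> \<bar>\<phi> f - c * f x\<bar> \<le> e"
proof -
  obtain U where U: "openin X U" "x \<in> U"
    and small: "\<And>f. f \<in> Cfun X \<Longrightarrow> \<forall>y. \<bar>f y\<bar> \<le> 1 \<and> (y \<notin> U \<longrightarrow> f y = 0) \<Longrightarrow> f x = 0 \<Longrightarrow> \<bar>\<phi> f\<bar> \<le> e / 2"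
    using bounded_functional_small_near_point[OF \<phi> x half_gt_zero[OF e]] by blast
  obtain u where u: "u \<in> Cfun X" "u x = 1" "\<And>y. 0 \<le> u y" "\<And>y. u y \<le> 1" "\<And>y. y \<notin> U \<Longrightarrow> u y = 0"
    using Cfun_bump[OF X U] by metis
  show ?thesis
  proof (rule that[OF U])
    fix f assume f: "f \<in> Cfun X" "\<forall>y. \<bar>f y\<bar> \<le> 1 \<and> (y \<notin> U \<longrightarrow> f y = 0)"
    define g where "g = (\<lambda>y. f y - f x * u y)"
    have g: "g \<in> Cfun X"
      unfolding g_def using f u by (intro Cfun_diff Cfun_scale)
    have "\<bar>g y\<bar> \<le> 2" for y
    proof -
      have "\<bar>f x * u y\<bar> \<le> 1"
        using f u(3,4)[of y] by (simp add: abs_mult mult_le_one)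
      then show ?thesis using f(2)[rule_format, of y] unfolding g_def by linarith
    qed
    \<comment> \<open>\<open>g\<close> is only bounded by 2, so it is halved; this is why
      \<open>U\<close> was chosen for \<open>e / 2\<close>.\<close>
    then have "\<bar>\<phi> (\<lambda>y. 1/2 * g y)\<bar> \<le> e / 2"
      using f u(2,5) by (intro small Cfun_scale g) (auto simp: g_def)
    then have "\<bar>\<phi> g\<bar> \<le> e"
      unfolding bounded_functional_scale[OF \<phi> g] by (simp add: abs_mult)
    moreover have "\<phi> g = \<phi> f - \<phi> u * f x"
      unfolding g_def using f u
      by (simp add: bounded_functional_diff[OF \<phi>] bounded_functional_scale[OF \<phi>] Cfun_scale)
    ultimately show "\<bar>\<phi> f - \<phi> u * f x\<bar> \<le> e" by simp
  qed
qed

section \<open>Approximation by point evaluations on countable compact sets\<close>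

lemma countable_compact_dual_approx:
  assumes X: "completely_regular_space X" and K: "compactin X K" "countable K"
    and \<phi>: "bounded_functional X K C \<phi>" and e: "e > 0"
  obtains F c where "finite F" "F \<subseteq> K"
    "\<And>f. f \<in> Cfun X \<Longrightarrow> \<forall>x\<in>K. \<bar>f x\<bar> \<le> 1 \<Longrightarrow> \<bar>\<phi> f - (\<Sum>x\<in>F. c x * f x)\<bar> \<le> e"
proof -
  \<comment> \<open>The number of pieces is known only after compactness is applied. Countability of
    \<open>K\<close> lets each point receive its error in advance, with total at most
    \<open>e\<close>.\<close>
  define w where "w x = e * (1/2) ^ Suc (to_nat_on K x)" for x
  have w_sum: "(\<Sum>x\<in>F. w x) \<le> e" if F: "finite F" "F \<subseteq> K" for F
  proof -
    have "inj_on (to_nat_on K) F"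
      using K(2) F(2) inj_on_subset inj_on_to_nat_on by blast
    then have "(\<Sum>x\<in>F. (1/2::real) ^ Suc (to_nat_on K x)) = (\<Sum>n\<in>to_nat_on K ` F. (1/2) ^ Suc n)"
      by (simp add: sum.reindex)
    also have "\<dots> \<le> (\<Sum>n. (1/2) ^ Suc n)"
      using F(1) sums_summable[OF power_half_series] by (intro sum_le_suminf) auto
    also have "\<dots> = 1"
      using sums_unique[OF power_half_series] by simp
    finally show ?thesis
      using mult_left_mono[of _ 1 e] e unfolding w_def sum_distrib_left[symmetric] by simp
  qed
  have KX: "K \<subseteq> topspace X"
    by (rule compactin_subset_topspace[OF K(1)])
  have "\<exists>U c v. openin X U \<and> x \<in> U \<and>
      (\<forall>f\<in>Cfun X. (\<forall>y. \<bar>f y\<bar> \<le> 1 \<and> (y \<notin> U \<longrightarrow> f y = 0)) \<longrightarrow> \<bar>\<phi> f - c * f x\<bar> \<le> w x) \<and>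
      v \<in> Cfun X \<and> v x = 1 \<and> (\<forall>y. 0 \<le> v y \<and> (y \<notin> U \<longrightarrow> v y = 0))" if x: "x \<in> K" for x
  proof -
    have "w x > 0" using e by (simp add: w_def)
    have "x \<in> topspace X" using x KX by blast
    obtain U c where U: "openin X U" "x \<in> U"
      "\<And>f. f \<in> Cfun X \<Longrightarrow> \<forall>y. \<bar>f y\<bar> \<le> 1 \<and> (y \<notin> U \<longrightarrow> f y = 0) \<Longrightarrow> \<bar>\<phi> f - c * f x\<bar> \<le> w x"
      using bounded_functional_near_point[OF X \<phi> \<open>x \<in> topspace X\<close> \<open>w x > 0\<close>] by blast
    obtain v where "v \<in> Cfun X" "v x = 1" "\<And>y. 0 \<le> v y" "\<And>y. y \<notin> U \<Longrightarrow> v y = 0"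
      using Cfun_bump[OF X U(1,2)] by metis
    with U show ?thesis by (intro exI[of _ U] exI[of _ c] exI[of _ v]) blast
  qed
  then have "\<forall>x\<in>K. \<exists>U c v. openin X U \<and> x \<in> U \<and>
      (\<forall>f\<in>Cfun X. (\<forall>y. \<bar>f y\<bar> \<le> 1 \<and> (y \<notin> U \<longrightarrow> f y = 0)) \<longrightarrow> \<bar>\<phi> f - c * f x\<bar> \<le> w x) \<and>
      v \<in> Cfun X \<and> v x = 1 \<and> (\<forall>y. 0 \<le> v y \<and> (y \<notin> U \<longrightarrow> v y = 0))"
    by (rule ballI)
  from bchoice[OF this] obtain U where "\<forall>x\<in>K. \<exists>c v. openin X (U x) \<and> x \<in> U x \<and>
      (\<forall>f\<in>Cfun X. (\<forall>y. \<bar>f y\<bar> \<le> 1 \<and> (y \<notin> U x \<longrightarrow> f y = 0)) \<longrightarrow> \<bar>\<phi> f - c * f x\<bar> \<le> w x) \<and>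
      v \<in> Cfun X \<and> v x = 1 \<and> (\<forall>y. 0 \<le> v y \<and> (y \<notin> U x \<longrightarrow> v y = 0))"
    by (elim exE)
  from bchoice[OF this] obtain c where "\<forall>x\<in>K. \<exists>v. openin X (U x) \<and> x \<in> U x \<and>
      (\<forall>f\<in>Cfun X. (\<forall>y. \<bar>f y\<bar> \<le> 1 \<and> (y \<notin> U x \<longrightarrow> f y = 0)) \<longrightarrow> \<bar>\<phi> f - c x * f x\<bar> \<le> w x) \<and>
      v \<in> Cfun X \<and> v x = 1 \<and> (\<forall>y. 0 \<le> v y \<and> (y \<notin> U x \<longrightarrow> v y = 0))"
    by (elim exE)
  from bchoice[OF this] obtain v where Ucv: "\<forall>x\<in>K. openin X (U x) \<and> x \<in> U x \<and>
      (\<forall>f\<in>Cfun X. (\<forall>y. \<bar>f y\<bar> \<le> 1 \<and> (y \<notin> U x \<longrightarrow> f y = 0)) \<longrightarrow> \<bar>\<phi> f - c x * f x\<bar> \<le> w x) \<and>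
      v x \<in> Cfun X \<and> v x x = 1 \<and> (\<forall>y. 0 \<le> v x y \<and> (y \<notin> U x \<longrightarrow> v x y = 0))"
    by (elim exE)
  then have v: "v x \<in> Cfun X" "v x x = 1" "0 \<le> v x y" "y \<notin> U x \<Longrightarrow> v x y = 0"
    and near: "\<And>f. f \<in> Cfun X \<Longrightarrow> \<forall>y. \<bar>f y\<bar> \<le> 1 \<and> (y \<notin> U x \<longrightarrow> f y = 0) \<Longrightarrow> \<bar>\<phi> f - c x * f x\<bar> \<le> w x"
    if "x \<in> K" for x y
    using that by simp_all
  define W where "W x = {y \<in> topspace X. v x y \<in> {1/2<..}}" for x
  have "\<forall>V\<in>W ` K. openin X V"
    unfolding W_def using v(1) openin_Cfun_vimage[OF _ open_greaterThan] by blast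
  moreover have "K \<subseteq> \<Union>(W ` K)"
    using v(2) KX by (auto simp: W_def)
  ultimately obtain \<F> where \<F>: "finite \<F>" "\<F> \<subseteq> W ` K" "K \<subseteq> \<Union>\<F>"
    using K(1) unfolding compactin_def by meson
  from finite_subset_image[OF \<F>(1,2)] obtain F where F: "F \<subseteq> K" "finite F" "\<F> = W ` F"
    by blast
  \<comment> \<open>On \<open>K\<close> some \<open>v x\<close> exceeds 1/2, so the maximum is
    inactive there and division by \<open>s\<close> gives a partition of unity on \<open>K\<close>;
    elsewhere it keeps \<open>s\<close> away from 0.\<close>
  define s where "s y = max (1/2) (\<Sum>x\<in>F. v x y)" for y
  have s_pos: "s y > 0" for y
    by (simp add: s_def max_def)
  have s_cont: "continuous_map X euclideanreal (\<lambda>y. inverse (s y))"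
  proof (intro continuous_map_real_inverse)
    show "continuous_map X euclideanreal s"
      unfolding s_def using F v(1)
      by (intro continuous_map_real_max continuous_map_canonical_const Cfun_continuous_map Cfun_sum) auto
  qed (use s_pos in \<open>auto simp: less_imp_neq[symmetric]\<close>)
  have s_K: "s y = (\<Sum>x\<in>F. v x y)" if y: "y \<in> K" for y
  proof -
    obtain x where x: "x \<in> F" "v x y > 1/2"
      using \<F>(3) F(3) y by (auto simp: W_def)
    then have "v x y \<le> (\<Sum>x\<in>F. v x y)"
      using v(3) F by (intro member_le_sum) auto
    then show ?thesis using x by (simp add: s_def)
  qed
  have v_le: "v x y \<le> s y" if "x \<in> F" for x y
  proof -
    have "v x y \<le> (\<Sum>x\<in>F. v x y)"
      using v(3) F that by (intro member_le_sum) auto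
    then show ?thesis by (simp add: s_def)
  qed
  define h where "h x y = v x y * inverse (s y)" for x y
  have h: "h x \<in> Cfun X" if "x \<in> F" for x
    unfolding h_def using v(1) F that s_cont by (intro Cfun_mult) auto
  have h01: "0 \<le> h x y" "h x y \<le> 1" if "x \<in> F" for x y
    using v(3) F(1) that v_le[OF that, of y] s_pos[of y]
    by (auto simp: h_def field_simps intro!: divide_nonneg_pos)
  show ?thesis
  \<comment> \<open>The piece of \<open>f\<close> at \<open>x\<close> has the value
    \<open>f x * h x x\<close> at \<open>x\<close>, so \<open>h x x\<close> enters the
    coefficient.\<close>
  proof (rule that[OF F(2,1), of "\<lambda>x. c x * h x x"])
    fix f assume f: "f \<in> Cfun X" "\<forall>x\<in>K. \<bar>f x\<bar> \<le> 1"
    \<comment> \<open>\<open>f\<close> is bounded by 1 only on \<open>K\<close>, but the local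
      estimates need this bound everywhere; clipping changes nothing on \<open>K\<close>.\<close>
    define g where "g y = max (- 1) (min 1 (f y))" for y
    have g: "g \<in> Cfun X"
      unfolding g_def using Cfun_clip[OF f(1), of 1] by simp
    have gK: "g y = f y" if "y \<in> K" for y
      using f(2) that by (auto simp: g_def abs_le_iff max_def min_def)
    have g1: "\<bar>g y\<bar> \<le> 1" for y
      by (auto simp: g_def)
    have gh: "(\<lambda>y. g y * h x y) \<in> Cfun X" if "x \<in> F" for x
      using g h[OF that] by (intro Cfun_mult Cfun_continuous_map)
    have "\<phi> f = \<phi> (\<lambda>y. \<Sum>x\<in>F. g y * h x y)"
    proof (rule bounded_functional_cong[OF \<phi> f(1)])
      show "(\<lambda>y. \<Sum>x\<in>F. g y * h x y) \<in> Cfun X"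
        using gh by (intro Cfun_sum)
      fix y assume y: "y \<in> K"
      have "(\<Sum>x\<in>F. g y * h x y) = g y * ((\<Sum>x\<in>F. v x y) * inverse (s y))"
        by (simp add: h_def sum_distrib_left sum_distrib_right)
      also have "\<dots> = f y"
        using s_K[OF y] s_pos[of y] gK[OF y] by simp
      finally show "f y = (\<Sum>x\<in>F. g y * h x y)" by simp
    qed
    also have "\<dots> = (\<Sum>x\<in>F. \<phi> (\<lambda>y. g y * h x y))"
      using gh by (intro bounded_functional_sum[OF \<phi>])
    finally have "\<bar>\<phi> f - (\<Sum>x\<in>F. c x * h x x * f x)\<bar> =
        \<bar>\<Sum>x\<in>F. \<phi> (\<lambda>y. g y * h x y) - c x * (g x * h x x)\<bar>"
      using gK F(1) by (simp add: sum_subtractf subset_iff mult_ac)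
    also have "\<dots> \<le> (\<Sum>x\<in>F. w x)"
    proof (rule order_trans[OF sum_abs sum_mono])
      fix x assume x: "x \<in> F"
      then have xK: "x \<in> K" using F(1) by blast
      have "\<bar>g y * h x y\<bar> \<le> 1" for y
        using g1[of y] h01[OF x, of y] by (simp add: abs_mult mult_le_one)
      moreover have "g y * h x y = 0" if "y \<notin> U x" for y
        using v(4)[OF xK that] by (simp add: h_def)
      ultimately show "\<bar>\<phi> (\<lambda>y. g y * h x y) - c x * (g x * h x x)\<bar> \<le> w x"
        using near[OF xK gh[OF x]] by simp
    qed
    also have "\<dots> \<le> e"
      by (rule w_sum[OF F(2,1)])
    finally show "\<bar>\<phi> f - (\<Sum>x\<in>F. c x * h x x * f x)\<bar> \<le> e" .
  qed
qed

text \<open>After division by \<open>b\<close> the approximation applies; scaled back, its error is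
  \<open>e / 2\<close>, and smallness on \<open>F\<close> makes the finite combination less than
  \<open>e / 2\<close>.\<close>

lemma countable_compact_dual_pointwise:
  assumes X: "completely_regular_space X" and K: "compactin X K" "countable K"
    and \<phi>: "bounded_functional X K C \<phi>" and e: "e > 0" and b: "b > 0"
  obtains F d where "finite F" "F \<subseteq> K" "d > 0"
    "\<And>f. f \<in> Cfun X \<Longrightarrow> \<forall>x\<in>K. \<bar>f x\<bar> \<le> b \<Longrightarrow> \<forall>x\<in>F. \<bar>f x\<bar> < d \<Longrightarrow> \<bar>\<phi> f\<bar> < e"
proof -
  have "e / (2 * b) > 0" using e b by simp
  then obtain F c where F: "finite F" "F \<subseteq> K" and approx:
    "\<And>f. f \<in> Cfun X \<Longrightarrow> \<forall>x\<in>K. \<bar>f x\<bar> \<le> 1 \<Longrightarrow> \<bar>\<phi> f - (\<Sum>x\<in>F. c x * f x)\<bar> \<le> e / (2 * b)"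
    using countable_compact_dual_approx[OF X K \<phi>] by blast
  define M where "M = (\<Sum>x\<in>F. \<bar>c x\<bar>)"
  have M: "M \<ge> 0" by (simp add: M_def sum_nonneg)
  define d where "d = e / (2 * (M + 1))"
  have d: "d > 0" "M * d < e / 2"
    using e M by (auto simp: d_def field_simps)
  show ?thesis
  proof (rule that[OF F d(1)])
    fix f assume f: "f \<in> Cfun X" "\<forall>x\<in>K. \<bar>f x\<bar> \<le> b" "\<forall>x\<in>F. \<bar>f x\<bar> < d"
    have "\<bar>\<phi> (\<lambda>x. 1 / b * f x) - (\<Sum>x\<in>F. c x * (1 / b * f x))\<bar> \<le> e / (2 * b)"
      using f(2) b by (intro approx Cfun_scale f) (simp add: abs_mult)
    moreover have "\<phi> (\<lambda>x. 1 / b * f x) - (\<Sum>x\<in>F. c x * (1 / b * f x)) = (\<phi> f - (\<Sum>x\<in>F. c x * f x)) / b"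
      unfolding bounded_functional_scale[OF \<phi> f(1)]
      by (simp add: diff_divide_distrib sum_divide_distrib)
    ultimately have "\<bar>\<phi> f - (\<Sum>x\<in>F. c x * f x)\<bar> / b \<le> e / (2 * b)"
      using b by (simp only: abs_divide abs_of_pos)
    then have "\<bar>\<phi> f - (\<Sum>x\<in>F. c x * f x)\<bar> \<le> e / 2"
      using b by (simp add: field_simps)
    moreover have "\<bar>\<Sum>x\<in>F. c x * f x\<bar> \<le> M * d"
    proof -
      have "\<bar>\<Sum>x\<in>F. c x * f x\<bar> \<le> (\<Sum>x\<in>F. \<bar>c x\<bar> * d)"
        using f(3) by (intro order_trans[OF sum_abs sum_mono]) (auto simp: abs_mult less_imp_le intro!: mult_left_mono)
      then show ?thesis by (simp add: M_def sum_distrib_right)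
    qed
    ultimately show "\<bar>\<phi> f\<bar> < e" using d(2) by linarith
  qed
qed

section \<open>A countable k-network for the weak topology\<close>

lemma countable_imp_weakly_aleph0:
  assumes X: "completely_regular_space X" and met: "metrizable_space (compact_open X)"
    and cX: "countable (topspace X)"
  shows "aleph0_space (weak_Cc X)"
proof -
  obtain \<K> where \<K>: "countable \<K>" "\<And>K. K \<in> \<K> \<Longrightarrow> compactin X K"
    and dual: "\<And>\<phi>. \<phi> \<in> dual_Cc X \<Longrightarrow> \<exists>K\<in>\<K>. \<exists>C. bounded_functional X K C \<phi>"
    using countable_bounding_family[OF met] by blast
  \<comment> \<open>Finite sets of constraints are used as indices so that unions of indices give
    intersections, here and for the rational boxes \<open>O'\<close>.\<close>
  define B where "B P = {f \<in> Cfun X. \<forall>(K, b::nat)\<in>P. \<forall>x\<in>K. \<bar>f x\<bar> \<le> real b}" for P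
  define O' where "O' Q = {f \<in> Cfun X. \<forall>(x, r, s)\<in>Q. of_rat r < f x \<and> f x < of_rat s}" for Q
  define I where "I = {P. P \<subseteq> \<K> \<times> (UNIV::nat set) \<and> finite P}"
  define J where "J = {Q. Q \<subseteq> topspace X \<times> (UNIV::(rat \<times> rat) set) \<and> finite Q}"
  define \<N> where "\<N> = (\<lambda>(P, Q). B P \<inter> O' Q) ` (I \<times> J)"
  have "countable I" "countable J"
    using countable_Collect_finite_subset[of "\<K> \<times> (UNIV::nat set)"] \<K>(1)
      countable_Collect_finite_subset[of "topspace X \<times> (UNIV::(rat \<times> rat) set)"] cX
    by (simp_all add: I_def J_def conj_commute)
  then have "countable \<N>"
    unfolding \<N>_def by (intro countable_image countable_SIGMA)
  have openO: "openin (weak_Cc X) (O' Q)" if "Q \<in> J" for Q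
  proof -
    have "finite Q" using that by (simp add: J_def)
    have "O' Q = Cfun X \<inter> (\<Inter>q\<in>Q. {f \<in> Cfun X. f (fst q) \<in> {of_rat (fst (snd q))<..<of_rat (snd (snd q))}})"
      unfolding O'_def by fastforce
    moreover have "openin (weak_Cc X) {f \<in> Cfun X. f (fst q) \<in> {of_rat (fst (snd q))<..<of_rat (snd (snd q))}}"
      if "q \<in> Q" for q
      using that \<open>Q \<in> J\<close> by (intro openin_weak_Cc_basic eval_in_dual) (auto simp: J_def)
    moreover have "openin (weak_Cc X) (Cfun X)"
      using openin_topspace[of "weak_Cc X"] by simp
    ultimately show ?thesis
      using \<open>finite Q\<close> by (cases "Q = {}") (auto intro!: openin_Int openin_INT2)
  qed
  \<comment> \<open>The bound \<open>B P\<close> need not be open, so it must contain all of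
    \<open>A\<close>; only the open box \<open>O' Q\<close> depends on \<open>f\<close>, and such
    boxes will cover \<open>A\<close>.\<close>
  have local: "f \<in> U \<longrightarrow> (\<exists>P\<in>I. \<exists>Q\<in>J. A \<subseteq> B P \<and> f \<in> O' Q \<and> B P \<inter> O' Q \<subseteq> U)"
    if A: "compactin (weak_Cc X) A" and f: "f \<in> A" and U: "openin (weak_Cc X) U" for A U f
    using U
  proof (induction rule: weak_Cc_induct)
    case (Int U V)
    show ?case
    proof
      assume "f \<in> U \<inter> V"
      then obtain P Q P' Q' where "P \<in> I" "Q \<in> J" "A \<subseteq> B P" "f \<in> O' Q" "B P \<inter> O' Q \<subseteq> U"
        "P' \<in> I" "Q' \<in> J" "A \<subseteq> B P'" "f \<in> O' Q'" "B P' \<inter> O' Q' \<subseteq> V"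
        using Int.IH by auto
      moreover have "B (P \<union> P') = B P \<inter> B P'" "O' (Q \<union> Q') = O' Q \<inter> O' Q'"
        unfolding B_def O'_def ball_Un by blast+
      moreover have "P \<union> P' \<in> I" "Q \<union> Q' \<in> J"
        using calculation by (auto simp: I_def J_def)
      ultimately show "\<exists>P\<in>I. \<exists>Q\<in>J. A \<subseteq> B P \<and> f \<in> O' Q \<and> B P \<inter> O' Q \<subseteq> U \<inter> V"
        by (intro bexI[of _ "P \<union> P'"] bexI[of _ "Q \<union> Q'"]) auto
    qed
  next
    case (UN \<U>)
    show ?case
    proof
      assume "f \<in> \<Union>\<U>"
      then obtain U where U: "U \<in> \<U>" "f \<in> U" by blast
      then obtain P Q where "P \<in> I" "Q \<in> J" "A \<subseteq> B P" "f \<in> O' Q" "B P \<inter> O' Q \<subseteq> U"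
        using UN by blast
      then show "\<exists>P\<in>I. \<exists>Q\<in>J. A \<subseteq> B P \<and> f \<in> O' Q \<and> B P \<inter> O' Q \<subseteq> \<Union>\<U>"
        using U(1) by (intro bexI[of _ P] bexI[of _ Q]) auto
    qed
  next
    case (Basis \<phi> V)
    show ?case
    proof
      assume "f \<in> {f \<in> Cfun X. \<phi> f \<in> V}"
      then have fC: "f \<in> Cfun X" and "\<phi> f \<in> V" by auto
      then obtain e where e: "e > 0" "\<And>y. \<bar>y - \<phi> f\<bar> < e \<Longrightarrow> y \<in> V"
        using \<open>open V\<close> by (auto simp: open_dist dist_real_def)
      obtain K C where K: "K \<in> \<K>" and \<phi>: "bounded_functional X K C \<phi>"
        using dual[OF Basis(1)] by blast
      have Kc: "compactin X K" "countable K"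
        using \<K>(2)[OF K] cX compactin_subset_topspace countable_subset by blast+
      obtain b where b: "\<And>g x. g \<in> A \<Longrightarrow> x \<in> K \<Longrightarrow> \<bar>g x\<bar> \<le> b"
        using weakly_compact_imp_bounded[OF A Kc(1)] by blast
      \<comment> \<open>The 1 makes \<open>n\<close> positive. Differences of two functions bounded
        by \<open>n\<close> on \<open>K\<close> are bounded by \<open>2 * real n\<close>, the bound
        used next.\<close>
      obtain n :: nat where n: "max b 1 \<le> real n"
        using real_arch_simple by blast
      have n2: "2 * real n > 0" using n by simp
      obtain F d where F: "finite F" "F \<subseteq> K" "d > 0" and small:
        "\<And>g. g \<in> Cfun X \<Longrightarrow> \<forall>x\<in>K. \<bar>g x\<bar> \<le> 2 * real n \<Longrightarrow> \<forall>x\<in>F. \<bar>g x\<bar> < d \<Longrightarrow> \<bar>\<phi> g\<bar> < e"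
        using countable_compact_dual_pointwise[OF X Kc \<phi> e(1) n2] by blast
      have "\<exists>r. f x - d/2 < of_rat r \<and> of_rat r < f x" for x
        using of_rat_dense[of "f x - d/2" "f x"] F(3) by auto
      then obtain r where r: "\<And>x. f x - d/2 < of_rat (r x)" "\<And>x. of_rat (r x) < f x"
        by metis
      have "\<exists>s. f x < of_rat s \<and> of_rat s < f x + d/2" for x
        using of_rat_dense[of "f x" "f x + d/2"] F(3) by auto
      then obtain s where s: "\<And>x. f x < of_rat (s x)" "\<And>x. of_rat (s x) < f x + d/2"
        by metis
      define Q where "Q = (\<lambda>x. (x, r x, s x)) ` F"
      have "{(K, n)} \<in> I" using K by (simp add: I_def)
      moreover have "Q \<in> J"
        using F compactin_subset_topspace[OF Kc(1)] by (auto simp: J_def Q_def)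
      moreover have "A \<subseteq> B {(K, n)}"
        using b n compactin_subset_topspace[OF A] by (force simp: B_def)
      moreover have "f \<in> O' Q"
        using fC r s by (auto simp: O'_def Q_def)
      moreover have "B {(K, n)} \<inter> O' Q \<subseteq> {f \<in> Cfun X. \<phi> f \<in> V}"
      proof
        fix g assume g: "g \<in> B {(K, n)} \<inter> O' Q"
        then have gC: "g \<in> Cfun X" by (simp add: B_def)
        have "\<bar>g x - f x\<bar> \<le> 2 * real n" if "x \<in> K" for x
        proof -
          have "\<bar>g x\<bar> \<le> real n" using g that by (simp add: B_def)
          moreover have "\<bar>f x\<bar> \<le> real n" using b[OF f that] n by simp
          ultimately show ?thesis by linarith
        qed
        moreover have "\<bar>g x - f x\<bar> < d" if "x \<in> F" for x
        proof -
          have "of_rat (r x) < g x" "g x < of_rat (s x)"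
            using g that by (auto simp: O'_def Q_def)
          then show ?thesis using r[of x] s[of x] by linarith
        qed
        ultimately have "\<bar>\<phi> (\<lambda>x. g x - f x)\<bar> < e"
          by (intro small Cfun_diff gC fC) auto
        then show "g \<in> {f \<in> Cfun X. \<phi> f \<in> V}"
          using e(2) gC bounded_functional_diff[OF \<phi> gC fC] by auto
      qed
      ultimately show "\<exists>P\<in>I. \<exists>Q\<in>J. A \<subseteq> B P \<and> f \<in> O' Q \<and> B P \<inter> O' Q \<subseteq> {f \<in> Cfun X. \<phi> f \<in> V}"
        by blast
    qed
  qed auto
  have "k_network (weak_Cc X) \<N>"
    unfolding k_network_def
  proof (intro conjI allI impI ballI)
    show "N \<subseteq> topspace (weak_Cc X)" if "N \<in> \<N>" for N
      using that by (auto simp: \<N>_def B_def)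
    fix A U assume *: "compactin (weak_Cc X) A \<and> openin (weak_Cc X) U \<and> A \<subseteq> U"
    define \<O> where "\<O> = {O' Q | P Q. P \<in> I \<and> Q \<in> J \<and> A \<subseteq> B P \<and> B P \<inter> O' Q \<subseteq> U}"
    have "A \<subseteq> \<Union>\<O>"
    proof
      fix f assume "f \<in> A"
      then obtain P Q where "P \<in> I" "Q \<in> J" "A \<subseteq> B P" "f \<in> O' Q" "B P \<inter> O' Q \<subseteq> U"
        using local[of A f U] * by blast
      then show "f \<in> \<Union>\<O>" unfolding \<O>_def by blast
    qed
    moreover have "\<forall>V\<in>\<O>. openin (weak_Cc X) V"
      using openO by (auto simp: \<O>_def)
    ultimately obtain \<F> where \<F>: "finite \<F>" "\<F> \<subseteq> \<O>" "A \<subseteq> \<Union>\<F>"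
      using * unfolding compactin_def by meson
    \<comment> \<open>Intersecting a box with its bound loses no point of \<open>A\<close> and
      brings it inside \<open>U\<close>.\<close>
    have "\<forall>V\<in>\<F>. \<exists>N. N \<in> \<N> \<and> A \<inter> V \<subseteq> N \<and> N \<subseteq> U"
    proof
      fix V assume "V \<in> \<F>"
      then obtain P Q where "V = O' Q" "P \<in> I" "Q \<in> J" "A \<subseteq> B P" "B P \<inter> O' Q \<subseteq> U"
        using \<F>(2) unfolding \<O>_def by blast
      moreover from this have "B P \<inter> O' Q \<in> \<N>"
        unfolding \<N>_def by (intro image_eqI[of _ _ "(P, Q)"]) auto
      ultimately show "\<exists>N. N \<in> \<N> \<and> A \<inter> V \<subseteq> N \<and> N \<subseteq> U"
        by (intro exI[of _ "B P \<inter> O' Q"]) auto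
    qed
    from bchoice[OF this] obtain \<nu> where \<nu>: "\<forall>V\<in>\<F>. \<nu> V \<in> \<N> \<and> A \<inter> V \<subseteq> \<nu> V \<and> \<nu> V \<subseteq> U"
      by (elim exE)
    have "finite (\<nu> ` \<F>)" "\<nu> ` \<F> \<subseteq> \<N>" "\<Union>(\<nu> ` \<F>) \<subseteq> U"
      using \<F>(1) \<nu> by auto
    moreover have "A \<subseteq> \<Union>(\<nu> ` \<F>)"
    proof
      fix f assume "f \<in> A"
      then obtain V where "V \<in> \<F>" "f \<in> A \<inter> V" using \<F>(3) by blast
      then show "f \<in> \<Union>(\<nu> ` \<F>)" using \<nu> by blast
    qed
    ultimately show "\<exists>\<F>. finite \<F> \<and> \<F> \<subseteq> \<N> \<and> A \<subseteq> \<Union>\<F> \<and> \<Union>\<F> \<subseteq> U"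
      by (intro exI[of _ "\<nu> ` \<F>"] conjI)
  qed
  then show ?thesis
    using \<open>countable \<N>\<close> regular_space_weak_Cc unfolding aleph0_space_def by blast
qed

theorem theorem1p1:
  fixes X :: "'a topology"
  assumes "completely_regular_space X" and "Hausdorff_space X"
    and "Frechet_Cc X"
  shows "(aleph_space (weak_Cc X) \<longleftrightarrow> aleph0_space (weak_Cc X)) \<and>
         (aleph0_space (weak_Cc X) \<longleftrightarrow> countable (topspace X))"
proof -
  have "metrizable_space (compact_open X)"
    using assms(3) by (simp add: Frechet_Cc_def)
  \<comment> \<open>The equivalences close as a cycle: (a) gives (c), (c) gives (b), (b) gives
    (a).\<close>
  then show ?thesis
    using aleph0_imp_aleph_space[of "weak_Cc X"] weakly_aleph_imp_countable[OF assms(1,2)]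
      countable_imp_weakly_aleph0[OF assms(1)] by satx
qed

end
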